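(* Let $k$ be a commutative unital ring with $\operatorname{Char}(k)\neq 2$ and let $(T,[\,,\,,\,],\alpha)$ be a regular Hom-Lie triple system over $k$. Let $\mathcal{U}(T)=\langle T,T\rangle\oplus T$ be the Lie algebra, with automorphism $\alpha_{\mathcal U}$, defined in the context. Then the canonical inclusion $\iota_T:T\to\mathcal{U}(T)$, $a\mapsto 0+a$, is a universal imbedding of $(T,[\,,\,,\,],\alpha)$ into $(\mathcal{U}(T),\alpha_{\mathcal U})$. That is, $\iota_T$ is an imbedding, and for every pair $(L,\alpha_L)$ consisting of a Lie algebra $L$ over $k$ and a Lie algebra automorphism $\alpha_L$ of $L$, and every imbedding $\epsilon$ of $(T,[\,,\,,\,],\alpha)$ into $(L,\alpha_L)$, there is a unique Lie algebra homomorphism $\varphi:\mathcal{U}(T)\to L$ with $\varphi\circ\alpha_{\mathcal U}=\alpha_L\circ\varphi$ and $\varphi\circ\iota_T=\epsilon$.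
   Context: Throughout, $k$ is a commutative ring with identity, $\operatorname{Char}(k)\ne 2$; all modules, algebras and linear maps are over $k$. A Lie algebra is a $k$-module with a bilinear bracket satisfying $[x,x]=0$ and the Jacobi identity. A regular Hom-Lie triple system $(T,[\,,\,,\,],\alpha)$ is a $k$-module $T$ with a trilinear map $[\,,\,,\,]:T\times T\times T\to T$ and a bijective linear map $\alpha:T\to T$ such that for all $a,b,c,d,e\in T$: (i) $[a,a,b]=0$; (ii) $[a,b,c]+[b,c,a]+[c,a,b]=0$; (iii) $[\alpha(a),\alpha(b),[c,d,e]]=[[a,b,c],\alpha(d),\alpha(e)]+[\alpha(c),[a,b,d],\alpha(e)]+[\alpha(c),\alpha(d),[a,b,e]]$; (iv) $\alpha([a,b,c])=[\alpha(a),\alpha(b),\alpha(c)]$. Imbedding: for a Lie algebra $L$ with a Lie algebra automorphism $\alpha_L$, an imbedding of $(T,[\,,\,,\,],\alpha)$ into $(L,\alpha_L)$ is a linear map $\epsilon:T\to L$ (not required to be injective) such that $\epsilon([a,b,c])=\alpha_L([[\epsilon(a),\epsilon(b)],\epsilon(c)])$ for all $a,b,c\in T$ and $\epsilon\circ\alpha=\alpha_L\circ\epsilon$. Construction of $\mathcal{U}(T)$: for $X\in\operatorname{End}_k(T)$ put $X^{\alpha^{-1}}=\alpha^{-1}\circ X$. For $a,b\in T$ let $D_{ab}\in\operatorname{End}_k(T)$, $D_{ab}(c)=[a,b,c]$. Let $T\wedge T$ be the exterior square of $T$ over $k$, and let $\lambda:T\wedge T\to\operatorname{End}_k(T)$ be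 the linear map with $\lambda(a\wedge b)=D_{ab}$. For $X\in\operatorname{End}_k(T)$ let $X\cdot(a\wedge b)=X^{\alpha^{-1}}(a)\wedge b+a\wedge X^{\alpha^{-1}}(b)$, extended linearly to $T\wedge T$. Let $A(T\wedge T)=\operatorname{span}\{\lambda(x)\cdot x: x\in T\wedge T\}$, let $\langle T,T\rangle=(T\wedge T)/A(T\wedge T)$, and let $\langle a,b\rangle$ be the coset of $a\wedge b$. Then $\langle T,T\rangle$ is a Lie algebra with $[\langle a,b\rangle,\langle c,d\rangle]=\langle D_{ab}^{\alpha^{-1}}c,d\rangle+\langle c,D_{ab}^{\alpha^{-1}}d\rangle$, and there is a well-defined linear map $\mu:\langle T,T\rangle\to\operatorname{End}_k(T)$ with $\mu(\langle a,b\rangle)=D_{ab}$. The $k$-module $\mathcal{U}(T)=\langle T,T\rangle\oplus T$ is a Lie algebra with the bracket $$[X+a,Y+b]=\big([X,Y]+\langle a,b\rangle\big)+\big(\alpha^{-1}(\mu(X)(b))-\alpha^{-1}(\mu(Y)(a))\big)$$ for $X,Y\in\langle T,T\rangle$, $a,b\in T$. The Lie algebra automorphism $\alpha_{\mathcal U}$ of $\mathcal{U}(T)$ is the linear map with $\alpha_{\mathcal U}|_T=\alpha$ and $\alpha_{\mathcal U}(\langle a,b\rangle)=\langle\alpha(a),\alpha(b)\rangle$. *)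

theory Defs
  imports "HOL-Algebra.Module" "HOL-Algebra.AbelCoset" "HOL-Algebra.Multiplicative_Group"
begin

section \<open>Characteristic of a ring\<close>

text \<open>The additive order of \<open>1\<close>, with the value \<open>0\<close> if that order is infinite.\<close>

definition ring_char :: "('k, 'q) ring_scheme \<Rightarrow> nat" where
  "ring_char R = group.ord (add_monoid R) \<one>\<^bsub>R\<^esub>"


section \<open>Linear and multilinear maps\<close>

text \<open>
  Module records carry the unused ring fields \<^const>\<open>mult\<close> and \<^const>\<open>one\<close>; they are left
  \<^const>\<open>undefined\<close> in the modules constructed below.
\<close>

definition lin_hom ::
  "('k, 'q) ring_scheme \<Rightarrow> ('k, 'a, 'm) module_scheme \<Rightarrow> ('k, 'b, 'n) module_scheme \<Rightarrow> ('a \<Rightarrow> 'b) set"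
  where
  "lin_hom R M N = {f \<in> carrier M \<rightarrow> carrier N.
     (\<forall>x\<in>carrier M. \<forall>y\<in>carrier M. f (x \<oplus>\<^bsub>M\<^esub> y) = f x \<oplus>\<^bsub>N\<^esub> f y) \<and>
     (\<forall>r\<in>carrier R. \<forall>x\<in>carrier M. f (r \<odot>\<^bsub>M\<^esub> x) = r \<odot>\<^bsub>N\<^esub> f x)}"

definition bilin ::
  "('k, 'q) ring_scheme \<Rightarrow> ('k, 'a, 'm) module_scheme \<Rightarrow> ('k, 'b, 'n) module_scheme \<Rightarrow>
   ('k, 'c, 'p) module_scheme \<Rightarrow> ('a \<Rightarrow> 'b \<Rightarrow> 'c) set"
  where
  "bilin R M N P = {f.
     (\<forall>x\<in>carrier M. (\<lambda>y. f x y) \<in> lin_hom R N P) \<and>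
     (\<forall>y\<in>carrier N. (\<lambda>x. f x y) \<in> lin_hom R M P)}"

definition trilin :: "('k, 'q) ring_scheme \<Rightarrow> ('k, 'a, 'm) module_scheme \<Rightarrow> ('a \<Rightarrow> 'a \<Rightarrow> 'a \<Rightarrow> 'a) set"
  where
  "trilin R M = {f. \<forall>x\<in>carrier M. \<forall>y\<in>carrier M.
     (\<lambda>z. f z x y) \<in> lin_hom R M M \<and>
     (\<lambda>z. f x z y) \<in> lin_hom R M M \<and>
     (\<lambda>z. f x y z) \<in> lin_hom R M M}"

text \<open>Endomorphisms are represented by functions that are \<^const>\<open>undefined\<close> off the carrier.\<close>

definition end_mod :: "('k, 'q) ring_scheme \<Rightarrow> ('k, 'a, 'm) module_scheme \<Rightarrow> ('k, 'a \<Rightarrow> 'a) module"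
  where
  "end_mod R M =
    \<lparr>carrier = lin_hom R M M \<inter> extensional (carrier M),
     mult = undefined, one = undefined,
     zero = (\<lambda>x\<in>carrier M. \<zero>\<^bsub>M\<^esub>),
     add = (\<lambda>f g. \<lambda>x\<in>carrier M. f x \<oplus>\<^bsub>M\<^esub> g x),
     smult = (\<lambda>r f. \<lambda>x\<in>carrier M. r \<odot>\<^bsub>M\<^esub> f x)\<rparr>"


section \<open>Spans, quotients and the exterior square\<close>

definition mod_span :: "('k, 'q) ring_scheme \<Rightarrow> ('k, 'a, 'm) module_scheme \<Rightarrow> 'a set \<Rightarrow> 'a set" where
  "mod_span R M S = (\<lambda>N. submodule N R M) hull S"

definition quot_mod :: "('k, 'a, 'm) module_scheme \<Rightarrow> 'a set \<Rightarrow> ('k, 'a set) module" where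
  "quot_mod M N =
    \<lparr>carrier = a_rcosets\<^bsub>M\<^esub> N,
     mult = undefined, one = undefined,
     zero = N,
     add = set_add M,
     smult = (\<lambda>r X. \<Union>x\<in>X. N +>\<^bsub>M\<^esub> (r \<odot>\<^bsub>M\<^esub> x))\<rparr>"

definition free_mod :: "('k, 'q) ring_scheme \<Rightarrow> 's set \<Rightarrow> ('k, 's \<Rightarrow> 'k) module" where
  "free_mod R S =
    \<lparr>carrier = {f \<in> S \<rightarrow> carrier R. (\<forall>s. s \<notin> S \<longrightarrow> f s = \<zero>\<^bsub>R\<^esub>) \<and> finite {s \<in> S. f s \<noteq> \<zero>\<^bsub>R\<^esub>}},
     mult = undefined, one = undefined,
     zero = (\<lambda>s. \<zero>\<^bsub>R\<^esub>),
     add = (\<lambda>f g s. f s \<oplus>\<^bsub>R\<^esub> g s),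
     smult = (\<lambda>r f s. r \<otimes>\<^bsub>R\<^esub> f s)\<rparr>"

definition free_gen :: "('k, 'q) ring_scheme \<Rightarrow> 's \<Rightarrow> 's \<Rightarrow> 'k" where
  "free_gen R s = (\<lambda>t. if t = s then \<one>\<^bsub>R\<^esub> else \<zero>\<^bsub>R\<^esub>)"

definition wedge_rels ::
  "('k, 'q) ring_scheme \<Rightarrow> ('k, 'a, 'm) module_scheme \<Rightarrow> ('a \<times> 'a \<Rightarrow> 'k) set"
  where
  "wedge_rels R M =
    (let F = free_mod R (carrier M \<times> carrier M); e = (\<lambda>a b. free_gen R (a, b)) in
      {e (a \<oplus>\<^bsub>M\<^esub> b) c \<ominus>\<^bsub>F\<^esub> (e a c \<oplus>\<^bsub>F\<^esub> e b c) | a b c.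
          a \<in> carrier M \<and> b \<in> carrier M \<and> c \<in> carrier M} \<union>
      {e a (b \<oplus>\<^bsub>M\<^esub> c) \<ominus>\<^bsub>F\<^esub> (e a b \<oplus>\<^bsub>F\<^esub> e a c) | a b c.
          a \<in> carrier M \<and> b \<in> carrier M \<and> c \<in> carrier M} \<union>
      {e (r \<odot>\<^bsub>M\<^esub> a) b \<ominus>\<^bsub>F\<^esub> (r \<odot>\<^bsub>F\<^esub> e a b) | r a b.
          r \<in> carrier R \<and> a \<in> carrier M \<and> b \<in> carrier M} \<union>
      {e a (r \<odot>\<^bsub>M\<^esub> b) \<ominus>\<^bsub>F\<^esub> (r \<odot>\<^bsub>F\<^esub> e a b) | r a b.
          r \<in> carrier R \<and> a \<in> carrier M \<and> b \<in> carrier M} \<union>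
      {e a a | a. a \<in> carrier M})"

definition wedge_ker ::
  "('k, 'q) ring_scheme \<Rightarrow> ('k, 'a, 'm) module_scheme \<Rightarrow> ('a \<times> 'a \<Rightarrow> 'k) set"
  where
  "wedge_ker R M = mod_span R (free_mod R (carrier M \<times> carrier M)) (wedge_rels R M)"

definition ext_sq ::
  "('k, 'q) ring_scheme \<Rightarrow> ('k, 'a, 'm) module_scheme \<Rightarrow> ('k, ('a \<times> 'a \<Rightarrow> 'k) set) module"
  where
  "ext_sq R M = quot_mod (free_mod R (carrier M \<times> carrier M)) (wedge_ker R M)"

definition wedge ::
  "('k, 'q) ring_scheme \<Rightarrow> ('k, 'a, 'm) module_scheme \<Rightarrow> 'a \<Rightarrow> 'a \<Rightarrow> ('a \<times> 'a \<Rightarrow> 'k) set"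
  where
  "wedge R M a b =
     wedge_ker R M +>\<^bsub>free_mod R (carrier M \<times> carrier M)\<^esub> free_gen R (a, b)"


section \<open>Lie algebras\<close>

record ('k, 'a) lie_struct = "('k, 'a) module" +
  lie_br :: "'a \<Rightarrow> 'a \<Rightarrow> 'a"

locale lie_algebra = module R L
  for R :: "('k, 'q) ring_scheme" and L :: "('k, 'a, 'm) lie_struct_scheme" +
  assumes br_bilin: "lie_br L \<in> bilin R L L L"
    and br_self: "x \<in> carrier L \<Longrightarrow> lie_br L x x = \<zero>\<^bsub>L\<^esub>"
    and jacobi: "\<lbrakk>x \<in> carrier L; y \<in> carrier L; z \<in> carrier L\<rbrakk> \<Longrightarrow>
      lie_br L (lie_br L x y) z \<oplus>\<^bsub>L\<^esub> lie_br L (lie_br L y z) x \<oplus>\<^bsub>L\<^esub> lie_br L (lie_br L z x) y = \<zero>\<^bsub>L\<^esub>"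

definition lie_hom ::
  "('k, 'q) ring_scheme \<Rightarrow> ('k, 'a, 'm) lie_struct_scheme \<Rightarrow> ('k, 'b, 'n) lie_struct_scheme \<Rightarrow> ('a \<Rightarrow> 'b) set"
  where
  "lie_hom R L M = {f \<in> lin_hom R L M.
     \<forall>x\<in>carrier L. \<forall>y\<in>carrier L. f (lie_br L x y) = lie_br M (f x) (f y)}"

definition lie_aut :: "('k, 'q) ring_scheme \<Rightarrow> ('k, 'a, 'm) lie_struct_scheme \<Rightarrow> ('a \<Rightarrow> 'a) set" where
  "lie_aut R L = {f \<in> lie_hom R L L. bij_betw f (carrier L) (carrier L)}"


section \<open>Regular Hom-Lie triple systems\<close>

record ('k, 'a) hom_lts_struct = "('k, 'a) module" +
  tri :: "'a \<Rightarrow> 'a \<Rightarrow> 'a \<Rightarrow> 'a"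
  twist :: "'a \<Rightarrow> 'a"

locale regular_hom_lts = module R T
  for R :: "('k, 'q) ring_scheme" and T :: "('k, 'a, 'm) hom_lts_struct_scheme" +
  assumes tri_trilin: "tri T \<in> trilin R T"
    and twist_lin: "twist T \<in> lin_hom R T T"
    and twist_bij: "bij_betw (twist T) (carrier T) (carrier T)"
    and tri_alt: "\<lbrakk>a \<in> carrier T; b \<in> carrier T\<rbrakk> \<Longrightarrow> tri T a a b = \<zero>\<^bsub>T\<^esub>"
    and tri_cyclic: "\<lbrakk>a \<in> carrier T; b \<in> carrier T; c \<in> carrier T\<rbrakk> \<Longrightarrow>
      tri T a b c \<oplus>\<^bsub>T\<^esub> tri T b c a \<oplus>\<^bsub>T\<^esub> tri T c a b = \<zero>\<^bsub>T\<^esub>"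
    and tri_deriv:
      "\<lbrakk>a \<in> carrier T; b \<in> carrier T; c \<in> carrier T; d \<in> carrier T; e \<in> carrier T\<rbrakk> \<Longrightarrow>
      tri T (twist T a) (twist T b) (tri T c d e) =
        tri T (tri T a b c) (twist T d) (twist T e) \<oplus>\<^bsub>T\<^esub>
        tri T (twist T c) (tri T a b d) (twist T e) \<oplus>\<^bsub>T\<^esub>
        tri T (twist T c) (twist T d) (tri T a b e)"
    and twist_tri: "\<lbrakk>a \<in> carrier T; b \<in> carrier T; c \<in> carrier T\<rbrakk> \<Longrightarrow>
      twist T (tri T a b c) = tri T (twist T a) (twist T b) (twist T c)"

definition imbedding ::
  "('k, 'q) ring_scheme \<Rightarrow> ('k, 'a, 'm) hom_lts_struct_scheme \<Rightarrow>
   ('k, 'b, 'n) lie_struct_scheme \<Rightarrow> ('b \<Rightarrow> 'b) \<Rightarrow> ('a \<Rightarrow> 'b) \<Rightarrow> bool"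
  where
  "imbedding R T L \<alpha>L \<epsilon> \<longleftrightarrow>
     \<epsilon> \<in> lin_hom R T L \<and>
     (\<forall>a\<in>carrier T. \<forall>b\<in>carrier T. \<forall>c\<in>carrier T.
        \<epsilon> (tri T a b c) = \<alpha>L (lie_br L (lie_br L (\<epsilon> a) (\<epsilon> b)) (\<epsilon> c))) \<and>
     (\<forall>a\<in>carrier T. \<epsilon> (twist T a) = \<alpha>L (\<epsilon> a))"


section \<open>The Lie algebra of a regular Hom-Lie triple system\<close>

text \<open>
  A (bi)linear map given by its values on generators is rendered as \<open>THE\<close> (bi)linear map with
  these values; requiring it to be \<^const>\<open>extensional\<close> makes it unique as a total function.
\<close>

definition untwist :: "('k, 'a, 'm) hom_lts_struct_scheme \<Rightarrow> 'a \<Rightarrow> 'a" where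
  "untwist T = inv_into (carrier T) (twist T)"

definition twisted_end :: "('k, 'a, 'm) hom_lts_struct_scheme \<Rightarrow> ('a \<Rightarrow> 'a) \<Rightarrow> 'a \<Rightarrow> 'a" where
  "twisted_end T X = compose (carrier T) (untwist T) X"

definition tri_D :: "('k, 'a, 'm) hom_lts_struct_scheme \<Rightarrow> 'a \<Rightarrow> 'a \<Rightarrow> 'a \<Rightarrow> 'a" where
  "tri_D T a b = (\<lambda>c\<in>carrier T. tri T a b c)"

definition lam ::
  "('k, 'q) ring_scheme \<Rightarrow> ('k, 'a, 'm) hom_lts_struct_scheme \<Rightarrow> ('a \<times> 'a \<Rightarrow> 'k) set \<Rightarrow> 'a \<Rightarrow> 'a"
  where
  "lam R T = (THE f. f \<in> lin_hom R (ext_sq R T) (end_mod R T) \<inter> extensional (carrier (ext_sq R T)) \<and>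
     (\<forall>a\<in>carrier T. \<forall>b\<in>carrier T. f (wedge R T a b) = tri_D T a b))"

definition end_act ::
  "('k, 'q) ring_scheme \<Rightarrow> ('k, 'a, 'm) hom_lts_struct_scheme \<Rightarrow> ('a \<Rightarrow> 'a) \<Rightarrow>
   ('a \<times> 'a \<Rightarrow> 'k) set \<Rightarrow> ('a \<times> 'a \<Rightarrow> 'k) set"
  where
  "end_act R T X = (THE f. f \<in> lin_hom R (ext_sq R T) (ext_sq R T) \<inter> extensional (carrier (ext_sq R T)) \<and>
     (\<forall>a\<in>carrier T. \<forall>b\<in>carrier T. f (wedge R T a b) =
        wedge R T (twisted_end T X a) b \<oplus>\<^bsub>ext_sq R T\<^esub> wedge R T a (twisted_end T X b)))"

definition A_sub ::
  "('k, 'q) ring_scheme \<Rightarrow> ('k, 'a, 'm) hom_lts_struct_scheme \<Rightarrow> ('a \<times> 'a \<Rightarrow> 'k) set set"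
  where
  "A_sub R T = mod_span R (ext_sq R T) {end_act R T (lam R T x) x | x. x \<in> carrier (ext_sq R T)}"

definition ang_mod ::
  "('k, 'q) ring_scheme \<Rightarrow> ('k, 'a, 'm) hom_lts_struct_scheme \<Rightarrow> ('k, ('a \<times> 'a \<Rightarrow> 'k) set set) module"
  where
  "ang_mod R T = quot_mod (ext_sq R T) (A_sub R T)"

definition ang ::
  "('k, 'q) ring_scheme \<Rightarrow> ('k, 'a, 'm) hom_lts_struct_scheme \<Rightarrow> 'a \<Rightarrow> 'a \<Rightarrow> ('a \<times> 'a \<Rightarrow> 'k) set set"
  where
  "ang R T a b = A_sub R T +>\<^bsub>ext_sq R T\<^esub> wedge R T a b"

definition ang_br ::
  "('k, 'q) ring_scheme \<Rightarrow> ('k, 'a, 'm) hom_lts_struct_scheme \<Rightarrow>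
   ('a \<times> 'a \<Rightarrow> 'k) set set \<Rightarrow> ('a \<times> 'a \<Rightarrow> 'k) set set \<Rightarrow> ('a \<times> 'a \<Rightarrow> 'k) set set"
  where
  "ang_br R T = (THE f. f \<in> bilin R (ang_mod R T) (ang_mod R T) (ang_mod R T) \<and>
     f \<in> extensional (carrier (ang_mod R T)) \<and>
     (\<forall>X\<in>carrier (ang_mod R T). f X \<in> extensional (carrier (ang_mod R T))) \<and>
     (\<forall>a\<in>carrier T. \<forall>b\<in>carrier T. \<forall>c\<in>carrier T. \<forall>d\<in>carrier T.
        f (ang R T a b) (ang R T c d) =
          ang R T (twisted_end T (tri_D T a b) c) d \<oplus>\<^bsub>ang_mod R T\<^esub>
          ang R T c (twisted_end T (tri_D T a b) d)))"

definition mu ::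
  "('k, 'q) ring_scheme \<Rightarrow> ('k, 'a, 'm) hom_lts_struct_scheme \<Rightarrow> ('a \<times> 'a \<Rightarrow> 'k) set set \<Rightarrow> 'a \<Rightarrow> 'a"
  where
  "mu R T = (THE f. f \<in> lin_hom R (ang_mod R T) (end_mod R T) \<inter> extensional (carrier (ang_mod R T)) \<and>
     (\<forall>a\<in>carrier T. \<forall>b\<in>carrier T. f (ang R T a b) = tri_D T a b))"

definition U_alg ::
  "('k, 'q) ring_scheme \<Rightarrow> ('k, 'a, 'm) hom_lts_struct_scheme \<Rightarrow>
   ('k, ('a \<times> 'a \<Rightarrow> 'k) set set \<times> 'a) lie_struct"
  where
  "U_alg R T =
    \<lparr>carrier = carrier (ang_mod R T) \<times> carrier T,
     mult = undefined, one = undefined,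
     zero = (\<zero>\<^bsub>ang_mod R T\<^esub>, \<zero>\<^bsub>T\<^esub>),
     add = (\<lambda>(X, a) (Y, b). (X \<oplus>\<^bsub>ang_mod R T\<^esub> Y, a \<oplus>\<^bsub>T\<^esub> b)),
     smult = (\<lambda>r (X, a). (r \<odot>\<^bsub>ang_mod R T\<^esub> X, r \<odot>\<^bsub>T\<^esub> a)),
     lie_br = (\<lambda>(X, a) (Y, b).
       (ang_br R T X Y \<oplus>\<^bsub>ang_mod R T\<^esub> ang R T a b,
        untwist T (mu R T X b) \<ominus>\<^bsub>T\<^esub> untwist T (mu R T Y a)))\<rparr>"

definition U_incl ::
  "('k, 'q) ring_scheme \<Rightarrow> ('k, 'a, 'm) hom_lts_struct_scheme \<Rightarrow> 'a \<Rightarrow> ('a \<times> 'a \<Rightarrow> 'k) set set \<times> 'a"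
  where
  "U_incl R T a = (\<zero>\<^bsub>ang_mod R T\<^esub>, a)"

definition U_aut ::
  "('k, 'q) ring_scheme \<Rightarrow> ('k, 'a, 'm) hom_lts_struct_scheme \<Rightarrow>
   ('a \<times> 'a \<Rightarrow> 'k) set set \<times> 'a \<Rightarrow> ('a \<times> 'a \<Rightarrow> 'k) set set \<times> 'a"
  where
  "U_aut R T = (THE f. f \<in> lin_hom R (U_alg R T) (U_alg R T) \<inter> extensional (carrier (U_alg R T)) \<and>
     (\<forall>a\<in>carrier T. f (U_incl R T a) = U_incl R T (twist T a)) \<and>
     (\<forall>a\<in>carrier T. \<forall>b\<in>carrier T.
        f (ang R T a b, \<zero>\<^bsub>T\<^esub>) = (ang R T (twist T a) (twist T b), \<zero>\<^bsub>T\<^esub>)))"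

end

theory Submission
  imports Defs
begin

text \<open>
  The product \<open>{a,b,c} = \<alpha>\<^sup>-\<^sup>1[a,b,c]\<close> turns \<open>T\<close> into an ordinary Lie triple system with automorphism
  \<open>\<alpha>\<close>, and an imbedding is the same as a linear map \<open>\<epsilon>\<close> commuting with the automorphisms such that
  \<open>\<epsilon>{a,b,c} = [[\<epsilon>a,\<epsilon>b],\<epsilon>c]\<close>. The action \<open>x \<bullet> y\<close> of \<open>\<alpha>\<^sup>-\<^sup>1\<lambda>(x)\<close> on \<open>T \<and> T\<close> is by derivations, so it is
  a Leibniz product, and \<open>A(T \<and> T)\<close> is the smallest submodule making it alternating; \<open>\<lambda>\<close> vanishes
  on \<open>A(T \<and> T)\<close>, hence the quotient acts on \<open>T\<close>. Given \<open>\<epsilon>\<close>, the linear map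
  \<open>\<psi>(a \<and> b) = [\<epsilon>a,\<epsilon>b]\<close> satisfies \<open>\<psi>(x \<bullet> y) = [\<psi>x,\<psi>y]\<close>, so it kills \<open>A(T \<and> T)\<close> and
  \<open>\<phi>(X + a) = \<psi>X + \<epsilon>a\<close> is the homomorphism sought; it is unique as \<open>T\<close> generates \<open>U(T)\<close>. The
  same extension principle, applied to \<open>\<iota> \<circ> \<alpha>\<close> and \<open>\<iota> \<circ> \<alpha>\<^sup>-\<^sup>1\<close>, produces \<open>\<alpha>\<^sub>U\<close> and its inverse.
\<close>

section \<open>Linear maps, spans and quotients\<close>

lemma lin_homI:
  assumes "\<And>x. x \<in> carrier M \<Longrightarrow> f x \<in> carrier N"
    and "\<And>x y. x \<in> carrier M \<Longrightarrow> y \<in> carrier M \<Longrightarrow> f (x \<oplus>\<^bsub>M\<^esub> y) = f x \<oplus>\<^bsub>N\<^esub> f y"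
    and "\<And>r x. r \<in> carrier R \<Longrightarrow> x \<in> carrier M \<Longrightarrow> f (r \<odot>\<^bsub>M\<^esub> x) = r \<odot>\<^bsub>N\<^esub> f x"
  shows "f \<in> lin_hom R M N"
  using assms by (simp add: lin_hom_def)

lemma lin_hom_closed: "f \<in> lin_hom R M N \<Longrightarrow> x \<in> carrier M \<Longrightarrow> f x \<in> carrier N"
  by (auto simp: lin_hom_def)

lemma lin_hom_add:
  "f \<in> lin_hom R M N \<Longrightarrow> x \<in> carrier M \<Longrightarrow> y \<in> carrier M \<Longrightarrow> f (x \<oplus>\<^bsub>M\<^esub> y) = f x \<oplus>\<^bsub>N\<^esub> f y"
  by (simp add: lin_hom_def)

lemma lin_hom_smult:
  "f \<in> lin_hom R M N \<Longrightarrow> r \<in> carrier R \<Longrightarrow> x \<in> carrier M \<Longrightarrow> f (r \<odot>\<^bsub>M\<^esub> x) = r \<odot>\<^bsub>N\<^esub> f x"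
  by (simp add: lin_hom_def)

lemma lin_hom_comp: "f \<in> lin_hom R M N \<Longrightarrow> g \<in> lin_hom R N P \<Longrightarrow> (\<lambda>x. g (f x)) \<in> lin_hom R M P"
  by (auto simp: lin_hom_def Pi_def)

lemma lin_hom_cong:
  assumes "module R M" "f \<in> lin_hom R M N" "\<And>x. x \<in> carrier M \<Longrightarrow> g x = f x"
  shows "g \<in> lin_hom R M N"
proof -
  interpret module R M by fact
  show ?thesis
    using assms(2,3) by (auto simp: lin_hom_def Pi_def)
qed

lemma lin_hom_restrict: "module R M \<Longrightarrow> f \<in> lin_hom R M N \<Longrightarrow> restrict f (carrier M) \<in> lin_hom R M N"
  by (erule lin_hom_cong) auto

lemma bilinI:
  assumes "\<And>x y. x \<in> carrier M \<Longrightarrow> y \<in> carrier N \<Longrightarrow> f x y \<in> carrier P"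
    and "\<And>x x' y. x \<in> carrier M \<Longrightarrow> x' \<in> carrier M \<Longrightarrow> y \<in> carrier N \<Longrightarrow>
      f (x \<oplus>\<^bsub>M\<^esub> x') y = f x y \<oplus>\<^bsub>P\<^esub> f x' y"
    and "\<And>x y y'. x \<in> carrier M \<Longrightarrow> y \<in> carrier N \<Longrightarrow> y' \<in> carrier N \<Longrightarrow>
      f x (y \<oplus>\<^bsub>N\<^esub> y') = f x y \<oplus>\<^bsub>P\<^esub> f x y'"
    and "\<And>r x y. r \<in> carrier R \<Longrightarrow> x \<in> carrier M \<Longrightarrow> y \<in> carrier N \<Longrightarrow> f (r \<odot>\<^bsub>M\<^esub> x) y = r \<odot>\<^bsub>P\<^esub> f x y"
    and "\<And>r x y. r \<in> carrier R \<Longrightarrow> x \<in> carrier M \<Longrightarrow> y \<in> carrier N \<Longrightarrow> f x (r \<odot>\<^bsub>N\<^esub> y) = r \<odot>\<^bsub>P\<^esub> f x y"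
  shows "f \<in> bilin R M N P"
  using assms by (auto simp: bilin_def intro!: lin_homI)

lemma bilin_lin_right: "f \<in> bilin R M N P \<Longrightarrow> x \<in> carrier M \<Longrightarrow> f x \<in> lin_hom R N P"
  by (simp add: bilin_def)

lemma bilin_lin_left: "f \<in> bilin R M N P \<Longrightarrow> y \<in> carrier N \<Longrightarrow> (\<lambda>x. f x y) \<in> lin_hom R M P"
  by (simp add: bilin_def)

lemma bilin_closed: "f \<in> bilin R M N P \<Longrightarrow> x \<in> carrier M \<Longrightarrow> y \<in> carrier N \<Longrightarrow> f x y \<in> carrier P"
  by (rule lin_hom_closed[OF bilin_lin_right])

lemmas bilin_add_right = lin_hom_add[OF bilin_lin_right]
lemmas bilin_add_left = lin_hom_add[OF bilin_lin_left]
lemmas bilin_smult_right = lin_hom_smult[OF bilin_lin_right]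
lemmas bilin_smult_left = lin_hom_smult[OF bilin_lin_left]

section \<open>Cancellation identities in abelian groups\<close>

context abelian_group
begin

text \<open>Sets up the \<open>algebra\<close> method for a bare additive group: the identities
  below are applied in modules, where only addition and negation are at hand.\<close>

lemmas abelian_group_simprules [algebra abelian_group "zero G" "add G" "a_inv G" "a_minus G"] =
  a_closed zero_closed a_inv_closed minus_closed
  a_assoc l_zero l_neg a_comm minus_eq r_zero r_neg r_neg2 r_neg1 minus_add minus_minus
  a_lcomm

lemma minus_eq_zero_iff:
  assumes "x \<in> carrier G" "y \<in> carrier G"
  shows "x \<ominus> y = \<zero> \<longleftrightarrow> x = y"
proof
  assume "x \<ominus> y = \<zero>"
  then show "x = y"
    using assms minus_equality[of x "\<ominus> y"] by (simp add: a_minus_def)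
qed (use assms in \<open>simp add: a_minus_def r_neg\<close>)

lemma a_minus_zero: "x \<in> carrier G \<Longrightarrow> x \<ominus> \<zero> = x"
  using minus_equality[of \<zero> \<zero>] by (simp add: a_minus_def)

lemma add_minus_cancel_left: "x \<in> carrier G \<Longrightarrow> y \<in> carrier G \<Longrightarrow> (x \<oplus> y) \<ominus> x = y"
  by algebra

text \<open>Bookkeeping for the \<open>\<langle>T,T\<rangle>\<close> component of the Leibniz
  identity in \<open>U_alg\<close>. The letters \<open>t\<close> and \<open>k\<close> stand for
  wedge terms that occur twice with opposite signs, \<open>t\<close> on the left and
  \<open>k\<close> on the right.\<close>

lemma leibniz_wedge_cancel:
  assumes "P \<in> carrier G" "P' \<in> carrier G" "p \<in> carrier G" "q \<in> carrier G" "r \<in> carrier G"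
    "t \<in> carrier G" "s \<in> carrier G" "n \<in> carrier G" "k \<in> carrier G"
  shows "((P \<oplus> P') \<oplus> (p \<oplus> q)) \<oplus> (r \<ominus> t) \<oplus> (s \<oplus> (n \<oplus> t)) =
    ((P \<oplus> s) \<oplus> (p \<ominus> k)) \<oplus> ((P' \<oplus> (k \<oplus> r)) \<oplus> (q \<ominus> (\<ominus> n)))"
  using assms by algebra

text \<open>The same for the \<open>T\<close> component: \<open>\<ominus> (s \<oplus> t)\<close> is
  a triple product rewritten by the cyclic identity, and \<open>w\<close> is an iterated derivation
  that cancels on the right.\<close>

lemma leibniz_der_cancel:
  assumes "A \<in> carrier G" "B \<in> carrier G" "C \<in> carrier G" "u \<in> carrier G" "v \<in> carrier G"
    "w \<in> carrier G" "s \<in> carrier G" "t \<in> carrier G"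
  shows "((A \<oplus> u) \<ominus> (B \<oplus> v)) \<ominus> (C \<oplus> \<ominus> (s \<oplus> t)) =
    ((A \<oplus> s) \<ominus> (v \<ominus> w)) \<oplus> ((u \<ominus> (C \<oplus> w)) \<ominus> (B \<oplus> \<ominus> t))"
  using assms by algebra

lemma add_minus_add:
  assumes "a \<in> carrier G" "b \<in> carrier G" "c \<in> carrier G" "d \<in> carrier G"
  shows "(a \<oplus> b) \<ominus> (c \<oplus> d) = (a \<ominus> c) \<oplus> (b \<ominus> d)"
  using assms by algebra

lemma add_neg_add_cancel:
  assumes "a \<in> carrier G" "b \<in> carrier G"
  shows "a \<oplus> \<ominus> (a \<oplus> b) \<oplus> b = \<zero>"
  using assms by algebra

end

section \<open>Linear maps out of a module, submodules and spans\<close>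

context module
begin

lemma smult_left_commute:
  "r \<in> carrier R \<Longrightarrow> t \<in> carrier R \<Longrightarrow> x \<in> carrier M \<Longrightarrow> r \<odot>\<^bsub>M\<^esub> (t \<odot>\<^bsub>M\<^esub> x) = t \<odot>\<^bsub>M\<^esub> (r \<odot>\<^bsub>M\<^esub> x)"
  by (simp add: R.m_comm flip: smult_assoc1)

lemma lin_hom_zero:
  assumes "module R N" "f \<in> lin_hom R M N"
  shows "f \<zero>\<^bsub>M\<^esub> = \<zero>\<^bsub>N\<^esub>"
proof -
  interpret N: module R N by fact
  have "f (\<zero> \<odot>\<^bsub>M\<^esub> \<zero>\<^bsub>M\<^esub>) = \<zero> \<odot>\<^bsub>N\<^esub> f \<zero>\<^bsub>M\<^esub>"
    using assms(2) by (intro lin_hom_smult[OF assms(2)]) auto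
  then show ?thesis
    using lin_hom_closed[OF assms(2), of "\<zero>\<^bsub>M\<^esub>"] by simp
qed

lemma lin_hom_inv:
  assumes "module R N" "f \<in> lin_hom R M N" "x \<in> carrier M"
  shows "f (\<ominus>\<^bsub>M\<^esub> x) = \<ominus>\<^bsub>N\<^esub> f x"
proof -
  interpret N: module R N by fact
  have "f ((\<ominus> \<one>) \<odot>\<^bsub>M\<^esub> x) = (\<ominus> \<one>) \<odot>\<^bsub>N\<^esub> f x"
    using assms(3) by (intro lin_hom_smult[OF assms(2)]) auto
  then show ?thesis
    using lin_hom_closed[OF assms(2,3)] assms(3) by (simp add: smult_l_minus N.smult_l_minus)
qed

lemma lin_hom_minus:
  assumes "module R N" "f \<in> lin_hom R M N" "x \<in> carrier M" "y \<in> carrier M"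
  shows "f (x \<ominus>\<^bsub>M\<^esub> y) = f x \<ominus>\<^bsub>N\<^esub> f y"
  using assms by (simp add: a_minus_def lin_hom_add[OF assms(2)] lin_hom_inv[OF assms(1,2)])

text \<open>Negation is multiplication by \<open>\<ominus> \<one>\<close>, so closure under scalars
  already covers it.\<close>

lemma submoduleI':
  assumes "H \<subseteq> carrier M" "\<zero>\<^bsub>M\<^esub> \<in> H"
    and "\<And>a b. a \<in> H \<Longrightarrow> b \<in> H \<Longrightarrow> a \<oplus>\<^bsub>M\<^esub> b \<in> H"
    and smult: "\<And>a x. a \<in> carrier R \<Longrightarrow> x \<in> H \<Longrightarrow> a \<odot>\<^bsub>M\<^esub> x \<in> H"
  shows "submodule H R M"
proof (rule submoduleI)
  fix a assume "a \<in> H"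
  then show "\<ominus>\<^bsub>M\<^esub> a \<in> H"
    using smult[of "\<ominus> \<one>" a] assms(1) by (auto simp: smult_l_minus)
qed (use assms in auto)

lemma submodule_mod_span:
  assumes "S \<subseteq> carrier M"
  shows "submodule (mod_span R M S) R M"
proof -
  \<comment> \<open>The hull is an intersection of submodules; that it stays inside the carrier
    requires at least one member of the family.\<close>
  have carr: "carrier M \<in> {N. submodule N R M \<and> S \<subseteq> N}"
    using carrier_is_submodule assms by simp
  show ?thesis
    unfolding mod_span_def hull_def
  proof (rule submoduleI')
    show "\<Inter>{t. submodule t R M \<and> S \<subseteq> t} \<subseteq> carrier M"
      using carr by auto
    show "\<zero>\<^bsub>M\<^esub> \<in> \<Inter>{t. submodule t R M \<and> S \<subseteq> t}"
      using subgroup.one_closed submodule.axioms(1) by fastforce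
  qed (auto dest: submoduleE(4,5))
qed

lemma mod_span_minimal: "submodule N R M \<Longrightarrow> S \<subseteq> N \<Longrightarrow> mod_span R M S \<subseteq> N"
  unfolding mod_span_def by (rule hull_minimal)

lemma mod_span_base: "x \<in> S \<Longrightarrow> x \<in> mod_span R M S"
  unfolding mod_span_def by (rule hull_inc)

text \<open>The elements of the carrier with property \<open>P\<close> form a submodule containing
  \<open>S\<close>. This reduces vanishing of a linear map on \<open>wedge_ker\<close> or
  \<open>A_sub\<close> to the generators.\<close>

lemma mod_span_induct [consumes 2, case_names base zero add smult]:
  assumes "x \<in> mod_span R M S" "S \<subseteq> carrier M"
    and "\<And>s. s \<in> S \<Longrightarrow> P s" "P \<zero>\<^bsub>M\<^esub>"
    and "\<And>x y. x \<in> carrier M \<Longrightarrow> y \<in> carrier M \<Longrightarrow> P x \<Longrightarrow> P y \<Longrightarrow> P (x \<oplus>\<^bsub>M\<^esub> y)"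
    and "\<And>r x. r \<in> carrier R \<Longrightarrow> x \<in> carrier M \<Longrightarrow> P x \<Longrightarrow> P (r \<odot>\<^bsub>M\<^esub> x)"
  shows "P x"
proof -
  have "submodule {x \<in> carrier M. P x} R M"
    by (rule submoduleI') (use assms in auto)
  then have "mod_span R M S \<subseteq> {x \<in> carrier M. P x}"
    by (rule mod_span_minimal) (use assms in auto)
  then show ?thesis using assms(1) by auto
qed

end

section \<open>Quotient modules and the maps that descend to them\<close>

locale quotient = module R M + S?: submodule N R M
  for R :: "('k, 'q) ring_scheme" (structure) and M :: "('k, 'a, 'm) module_scheme" (structure) and N
begin

sublocale abelian_subgroup N M
  by (rule abelian_subgroupI3) (simp_all add: additive_subgroupI S.subgroup_axioms abelian_group_axioms)

lemma coset_eq_iff: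
  assumes "x \<in> carrier M" "y \<in> carrier M"
  shows "N +>\<^bsub>M\<^esub> x = N +>\<^bsub>M\<^esub> y \<longleftrightarrow> x \<ominus>\<^bsub>M\<^esub> y \<in> N"
  using a_rcos_module[of y x] a_repr_independence'[of x y] a_rcos_self[of x] assms
  by (auto simp: a_minus_def)

text \<open>The scalar action of \<open>quot_mod\<close> is a union of cosets over all
  representatives. Two representatives differ by an element of \<open>N\<close>, and so do their
  multiples; all members of the union coincide.\<close>

lemma quot_smult:
  assumes "r \<in> carrier R" "x \<in> carrier M"
  shows "r \<odot>\<^bsub>quot_mod M N\<^esub> (N +>\<^bsub>M\<^esub> x) = N +>\<^bsub>M\<^esub> (r \<odot>\<^bsub>M\<^esub> x)"
proof -
  have "N +>\<^bsub>M\<^esub> (r \<odot>\<^bsub>M\<^esub> y) = N +>\<^bsub>M\<^esub> (r \<odot>\<^bsub>M\<^esub> x)" if "y \<in> N +>\<^bsub>M\<^esub> x" for y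
  proof -
    have y: "y \<in> carrier M" using that assms a_elemrcos_carrier by blast
    have "y \<ominus>\<^bsub>M\<^esub> x \<in> N" using that y assms by (simp add: a_rcos_module a_minus_def)
    then have "r \<odot>\<^bsub>M\<^esub> (y \<ominus>\<^bsub>M\<^esub> x) \<in> N" using assms by simp
    then show ?thesis
      using y assms by (simp add: coset_eq_iff a_minus_def smult_r_distr smult_r_minus)
  qed
  then have "(\<Union>y\<in>N +>\<^bsub>M\<^esub> x. N +>\<^bsub>M\<^esub> (r \<odot>\<^bsub>M\<^esub> y)) = (\<Union>y\<in>N +>\<^bsub>M\<^esub> x. N +>\<^bsub>M\<^esub> (r \<odot>\<^bsub>M\<^esub> x))"
    by (rule SUP_cong[OF refl])
  also have "\<dots> = N +>\<^bsub>M\<^esub> (r \<odot>\<^bsub>M\<^esub> x)"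
    using a_rcos_self[OF assms(2)] by blast
  finally show ?thesis
    by (simp add: quot_mod_def)
qed

lemma quot_add:
  "x \<in> carrier M \<Longrightarrow> y \<in> carrier M \<Longrightarrow>
    (N +>\<^bsub>M\<^esub> x) \<oplus>\<^bsub>quot_mod M N\<^esub> (N +>\<^bsub>M\<^esub> y) = N +>\<^bsub>M\<^esub> (x \<oplus>\<^bsub>M\<^esub> y)"
  by (simp add: quot_mod_def a_rcos_sum)

lemma quot_zero: "\<zero>\<^bsub>quot_mod M N\<^esub> = N +>\<^bsub>M\<^esub> \<zero>\<^bsub>M\<^esub>"
  by (simp add: quot_mod_def a_subset)

lemma carrier_quot: "carrier (quot_mod M N) = (\<lambda>x. N +>\<^bsub>M\<^esub> x) ` carrier M"
  by (auto simp: quot_mod_def A_RCOSETS_def')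

lemma quot_eq_zero_iff: "x \<in> carrier M \<Longrightarrow> N +>\<^bsub>M\<^esub> x = \<zero>\<^bsub>quot_mod M N\<^esub> \<longleftrightarrow> x \<in> N"
  by (simp add: quot_zero coset_eq_iff M.a_minus_zero)

lemma module_quot: "module R (quot_mod M N)"
proof (rule moduleI)
  show "cring R" ..
  show "abelian_group (quot_mod M N)"
  proof (rule abelian_groupI)
    fix X assume "X \<in> carrier (quot_mod M N)"
    then obtain x where "x \<in> carrier M" "X = N +>\<^bsub>M\<^esub> x" by (auto simp: carrier_quot)
    then show "\<exists>Y\<in>carrier (quot_mod M N). Y \<oplus>\<^bsub>quot_mod M N\<^esub> X = \<zero>\<^bsub>quot_mod M N\<^esub>"
      by (intro bexI[of _ "N +>\<^bsub>M\<^esub> (\<ominus>\<^bsub>M\<^esub> x)"]) (auto simp: carrier_quot quot_add quot_zero M.l_neg)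
  qed (auto simp: carrier_quot quot_add quot_zero M.a_ac)
qed (auto simp: carrier_quot quot_add quot_smult smult_l_distr smult_r_distr smult_assoc1)

lemma proj_lin_hom: "(\<lambda>x. N +>\<^bsub>M\<^esub> x) \<in> lin_hom R M (quot_mod M N)"
  by (rule lin_homI) (auto simp: carrier_quot quot_add quot_smult)

text \<open>A map that kills \<open>N\<close> is constant on cosets, so it may be evaluated at a
  chosen representative. Making the result extensional lets it compete for the descriptions by
  \<open>THE\<close>.\<close>

lemma quot_lift:
  assumes "module R P" "f \<in> lin_hom R M P" "\<And>x. x \<in> N \<Longrightarrow> f x = \<zero>\<^bsub>P\<^esub>"
  obtains g where "g \<in> lin_hom R (quot_mod M N) P" "g \<in> extensional (carrier (quot_mod M N))"
    "\<And>x. x \<in> carrier M \<Longrightarrow> g (N +>\<^bsub>M\<^esub> x) = f x"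
proof -
  interpret P: module R P by fact
  note f = lin_hom_closed[OF assms(2)] lin_hom_add[OF assms(2)] lin_hom_smult[OF assms(2)]
  define g where "g = (\<lambda>X \<in> carrier (quot_mod M N). f (SOME x. x \<in> carrier M \<and> X = N +>\<^bsub>M\<^esub> x))"
  have g: "g (N +>\<^bsub>M\<^esub> x) = f x" if x: "x \<in> carrier M" for x
  proof -
    define y where "y = (SOME y. y \<in> carrier M \<and> N +>\<^bsub>M\<^esub> x = N +>\<^bsub>M\<^esub> y)"
    have y: "y \<in> carrier M" "N +>\<^bsub>M\<^esub> x = N +>\<^bsub>M\<^esub> y"
      using someI[of "\<lambda>y. y \<in> carrier M \<and> N +>\<^bsub>M\<^esub> x = N +>\<^bsub>M\<^esub> y" x] x by (auto simp: y_def)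
    then have "f (x \<ominus>\<^bsub>M\<^esub> y) = \<zero>\<^bsub>P\<^esub>" using x by (simp add: coset_eq_iff assms(3))
    then have "f x = f y"
      using x y f by (simp add: lin_hom_minus[OF assms(1,2)] P.minus_eq_zero_iff)
    then show ?thesis using x by (auto simp: g_def carrier_quot y_def)
  qed
  show ?thesis
  proof
    show "g \<in> extensional (carrier (quot_mod M N))" by (simp add: g_def)
    show "g \<in> lin_hom R (quot_mod M N) P"
      by (rule lin_homI) (auto simp: carrier_quot quot_add quot_smult g f)
  qed (rule g)
qed

text \<open>The bilinear counterpart: \<open>N\<close> has to be annihilated in either argument, and
  representatives are exchanged in one argument after the other.\<close>

lemma quot_lift_bilin:
  assumes "module R P" and B: "B \<in> bilin R M M P"
    and "\<And>n x. n \<in> N \<Longrightarrow> x \<in> carrier M \<Longrightarrow> B n x = \<zero>\<^bsub>P\<^esub>"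
    and "\<And>n x. n \<in> N \<Longrightarrow> x \<in> carrier M \<Longrightarrow> B x n = \<zero>\<^bsub>P\<^esub>"
  obtains f where "f \<in> bilin R (quot_mod M N) (quot_mod M N) P"
    "f \<in> extensional (carrier (quot_mod M N))"
    "\<And>X. X \<in> carrier (quot_mod M N) \<Longrightarrow> f X \<in> extensional (carrier (quot_mod M N))"
    "\<And>x y. x \<in> carrier M \<Longrightarrow> y \<in> carrier M \<Longrightarrow> f (N +>\<^bsub>M\<^esub> x) (N +>\<^bsub>M\<^esub> y) = B x y"
proof -
  interpret P: module R P by fact
  define rep where "rep X = (SOME x. x \<in> carrier M \<and> X = N +>\<^bsub>M\<^esub> x)" for X
  have rep: "rep (N +>\<^bsub>M\<^esub> x) \<in> carrier M" "x \<ominus>\<^bsub>M\<^esub> rep (N +>\<^bsub>M\<^esub> x) \<in> N" if "x \<in> carrier M" for x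
    using someI[of "\<lambda>y. y \<in> carrier M \<and> N +>\<^bsub>M\<^esub> x = N +>\<^bsub>M\<^esub> y" x] that
    by (auto simp: rep_def simp flip: coset_eq_iff)
  define f where "f = (\<lambda>X \<in> carrier (quot_mod M N). \<lambda>Y \<in> carrier (quot_mod M N). B (rep X) (rep Y))"
  have f: "f (N +>\<^bsub>M\<^esub> x) (N +>\<^bsub>M\<^esub> y) = B x y" if x: "x \<in> carrier M" and y: "y \<in> carrier M" for x y
  proof -
    let ?x = "rep (N +>\<^bsub>M\<^esub> x)" and ?y = "rep (N +>\<^bsub>M\<^esub> y)"
    note x' = rep[OF x] and y' = rep[OF y]
    \<comment> \<open>First \<open>x\<close> is replaced by its representative with \<open>y\<close>
      fixed, then \<open>y\<close> with the new first argument fixed.\<close>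
    have "B x y \<ominus>\<^bsub>P\<^esub> B ?x y = \<zero>\<^bsub>P\<^esub>"
      using lin_hom_minus[OF assms(1) bilin_lin_left[OF B y] x x'(1)] assms(3)[OF x'(2) y] by simp
    moreover have "B ?x y \<ominus>\<^bsub>P\<^esub> B ?x ?y = \<zero>\<^bsub>P\<^esub>"
      using lin_hom_minus[OF assms(1) bilin_lin_right[OF B x'(1)] y y'(1)] assms(4)[OF y'(2) x'(1)] by simp
    ultimately have "B x y = B ?x ?y"
      using x y x' y' by (simp add: P.minus_eq_zero_iff bilin_closed[OF B])
    then show ?thesis
      using x y by (auto simp: f_def carrier_quot)
  qed
  show ?thesis
  proof
    show "f \<in> bilin R (quot_mod M N) (quot_mod M N) P"
      by (rule bilinI) (auto simp: carrier_quot quot_add quot_smult f bilin_closed[OF B]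
          bilin_add_left[OF B] bilin_add_right[OF B] bilin_smult_left[OF B] bilin_smult_right[OF B])
  next
    show "f (N +>\<^bsub>M\<^esub> x) (N +>\<^bsub>M\<^esub> y) = B x y" if "x \<in> carrier M" "y \<in> carrier M" for x y
      using that by (rule f)
  qed (auto simp: f_def)
qed

end
section \<open>Free modules and the exterior square\<close>

context cring
begin

lemma module_free_mod: "module R (free_mod R S)"
proof (rule moduleI)
  show "abelian_group (free_mod R S)"
  proof (rule abelian_groupI)
    fix f g assume f: "f \<in> carrier (free_mod R S)" and g: "g \<in> carrier (free_mod R S)"
    have "{s \<in> S. f s \<oplus> g s \<noteq> \<zero>} \<subseteq> {s \<in> S. f s \<noteq> \<zero>} \<union> {s \<in> S. g s \<noteq> \<zero>}"
      by auto
    with f g show "f \<oplus>\<^bsub>free_mod R S\<^esub> g \<in> carrier (free_mod R S)"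
      by (auto simp: free_mod_def intro: finite_subset)
  next
    fix f assume f: "f \<in> carrier (free_mod R S)"
    have neg: "{s \<in> S. \<ominus> f s \<noteq> \<zero>} \<subseteq> {s \<in> S. f s \<noteq> \<zero>}"
      by auto
    have "(\<lambda>s. \<ominus> f s) \<in> carrier (free_mod R S)"
      using f by (auto simp: free_mod_def intro: finite_subset[OF neg])
    \<comment> \<open>Equality of elements is equality of functions on the whole type. Off
      \<open>S\<close> the values are \<open>\<zero>\<close>, hence the case split here and in the
      laws that follow.\<close>
    moreover have "\<ominus> f s \<oplus> f s = \<zero>" for s
      using f by (cases "s \<in> S") (auto simp: free_mod_def Pi_iff l_neg)
    then have "(\<lambda>s. \<ominus> f s) \<oplus>\<^bsub>free_mod R S\<^esub> f = \<zero>\<^bsub>free_mod R S\<^esub>"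
      by (simp add: free_mod_def)
    ultimately show "\<exists>g\<in>carrier (free_mod R S). g \<oplus>\<^bsub>free_mod R S\<^esub> f = \<zero>\<^bsub>free_mod R S\<^esub>"
      by blast
  next
    fix f g assume "f \<in> carrier (free_mod R S)" "g \<in> carrier (free_mod R S)"
    then have "f s \<oplus> g s = g s \<oplus> f s" for s
      by (cases "s \<in> S") (auto simp: free_mod_def Pi_iff a_comm)
    then show "f \<oplus>\<^bsub>free_mod R S\<^esub> g = g \<oplus>\<^bsub>free_mod R S\<^esub> f"
      by (simp add: free_mod_def)
  next
    fix f g h assume "f \<in> carrier (free_mod R S)" "g \<in> carrier (free_mod R S)" "h \<in> carrier (free_mod R S)"
    then have "f s \<oplus> g s \<oplus> h s = f s \<oplus> (g s \<oplus> h s)" for s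
      by (cases "s \<in> S") (auto simp: free_mod_def Pi_iff a_assoc)
    then show "f \<oplus>\<^bsub>free_mod R S\<^esub> g \<oplus>\<^bsub>free_mod R S\<^esub> h = f \<oplus>\<^bsub>free_mod R S\<^esub> (g \<oplus>\<^bsub>free_mod R S\<^esub> h)"
      by (simp add: free_mod_def)
  next
    fix f assume "f \<in> carrier (free_mod R S)"
    then have "\<zero> \<oplus> f s = f s" for s
      by (cases "s \<in> S") (auto simp: free_mod_def Pi_iff)
    then show "\<zero>\<^bsub>free_mod R S\<^esub> \<oplus>\<^bsub>free_mod R S\<^esub> f = f"
      by (simp add: free_mod_def)
  qed (simp add: free_mod_def)
next
  fix r f assume r: "r \<in> carrier R" and f: "f \<in> carrier (free_mod R S)"
  have "{s \<in> S. r \<otimes> f s \<noteq> \<zero>} \<subseteq> {s \<in> S. f s \<noteq> \<zero>}"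
    using r by auto
  with r f show "r \<odot>\<^bsub>free_mod R S\<^esub> f \<in> carrier (free_mod R S)"
    by (auto simp: free_mod_def intro: finite_subset)
next
  fix r t f assume *: "r \<in> carrier R" "t \<in> carrier R" "f \<in> carrier (free_mod R S)"
  then have "(r \<oplus> t) \<otimes> f s = r \<otimes> f s \<oplus> t \<otimes> f s" "r \<otimes> t \<otimes> f s = r \<otimes> (t \<otimes> f s)" for s
    by (cases "s \<in> S"; auto simp: free_mod_def Pi_iff l_distr m_assoc)+
  then show "(r \<oplus> t) \<odot>\<^bsub>free_mod R S\<^esub> f = r \<odot>\<^bsub>free_mod R S\<^esub> f \<oplus>\<^bsub>free_mod R S\<^esub> t \<odot>\<^bsub>free_mod R S\<^esub> f"
    "(r \<otimes> t) \<odot>\<^bsub>free_mod R S\<^esub> f = r \<odot>\<^bsub>free_mod R S\<^esub> (t \<odot>\<^bsub>free_mod R S\<^esub> f)"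
    by (simp_all add: free_mod_def)
next
  fix r f g assume "r \<in> carrier R" "f \<in> carrier (free_mod R S)" "g \<in> carrier (free_mod R S)"
  then have "r \<otimes> (f s \<oplus> g s) = r \<otimes> f s \<oplus> r \<otimes> g s" for s
    by (cases "s \<in> S") (auto simp: free_mod_def Pi_iff r_distr)
  then show "r \<odot>\<^bsub>free_mod R S\<^esub> (f \<oplus>\<^bsub>free_mod R S\<^esub> g) =
      r \<odot>\<^bsub>free_mod R S\<^esub> f \<oplus>\<^bsub>free_mod R S\<^esub> r \<odot>\<^bsub>free_mod R S\<^esub> g"
    by (simp add: free_mod_def)
next
  fix f assume "f \<in> carrier (free_mod R S)"
  then have "\<one> \<otimes> f s = f s" for s
    by (cases "s \<in> S") (auto simp: free_mod_def Pi_iff)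
  then show "\<one> \<odot>\<^bsub>free_mod R S\<^esub> f = f"
    by (simp add: free_mod_def)
qed (rule is_cring)

lemma free_gen_closed: "s \<in> S \<Longrightarrow> free_gen R s \<in> carrier (free_mod R S)"
  by (auto simp: free_mod_def free_gen_def)

text \<open>Induction on the finite support: the coefficient at one point \<open>a\<close> is split
  off as a multiple of \<open>free_gen R a\<close>, and \<open>g\<close> is what remains.\<close>

lemma free_mod_induct [consumes 1, case_names zero gen add smult]:
  assumes "f \<in> carrier (free_mod R S)"
    and zero: "P \<zero>\<^bsub>free_mod R S\<^esub>"
    and gen: "\<And>s. s \<in> S \<Longrightarrow> P (free_gen R s)"
    and add: "\<And>f g. f \<in> carrier (free_mod R S) \<Longrightarrow> g \<in> carrier (free_mod R S) \<Longrightarrow> P f \<Longrightarrow> P g \<Longrightarrow>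
      P (f \<oplus>\<^bsub>free_mod R S\<^esub> g)"
    and smult: "\<And>r f. r \<in> carrier R \<Longrightarrow> f \<in> carrier (free_mod R S) \<Longrightarrow> P f \<Longrightarrow> P (r \<odot>\<^bsub>free_mod R S\<^esub> f)"
  shows "P f"
proof -
  interpret F: module R "free_mod R S" by (rule module_free_mod)
  have "\<forall>f \<in> carrier (free_mod R S). {s \<in> S. f s \<noteq> \<zero>} = A \<longrightarrow> P f" if "finite A" for A
    using that
  proof (induction A rule: finite_induct)
    case empty
    have "f = \<zero>\<^bsub>free_mod R S\<^esub>" if "f \<in> carrier (free_mod R S)" "{s \<in> S. f s \<noteq> \<zero>} = {}" for f
      using that by (auto simp: free_mod_def fun_eq_iff)
    then show ?case using zero by blast
  next
    case (insert a A)
    show ?case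
    proof (intro ballI impI)
      fix f assume f: "f \<in> carrier (free_mod R S)" and supp: "{s \<in> S. f s \<noteq> \<zero>} = insert a A"
      define g where "g = f(a := \<zero>)"
      have a: "a \<in> S" using supp by auto
      have fa: "f a \<in> carrier R" using f a by (auto simp: free_mod_def)
      have g_supp: "{s \<in> S. g s \<noteq> \<zero>} = A" using supp insert.hyps by (auto simp: g_def)
      have g: "g \<in> carrier (free_mod R S)"
        using f insert.hyps(1) g_supp by (auto simp: free_mod_def g_def)
      have "(\<lambda>s. f a \<otimes> free_gen R a s \<oplus> g s) = f"
      proof
        fix s show "f a \<otimes> free_gen R a s \<oplus> g s = f s"
          using f fa by (cases "s \<in> S") (auto simp: free_gen_def g_def free_mod_def Pi_iff)
      qed
      then have "(f a \<odot>\<^bsub>free_mod R S\<^esub> free_gen R a) \<oplus>\<^bsub>free_mod R S\<^esub> g = f"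
        by (simp add: free_mod_def)
      moreover have "P (f a \<odot>\<^bsub>free_mod R S\<^esub> free_gen R a \<oplus>\<^bsub>free_mod R S\<^esub> g)"
        using insert.IH g g_supp a fa by (intro add smult gen) (auto simp: free_gen_closed)
      ultimately show "P f" by simp
    qed
  qed
  moreover have "finite {s \<in> S. f s \<noteq> \<zero>}"
    using assms(1) by (simp add: free_mod_def)
  ultimately show ?thesis using assms(1) by blast
qed

lemma free_lift:
  assumes "module R P" and g: "g \<in> S \<rightarrow> carrier P"
  obtains h where "h \<in> lin_hom R (free_mod R S) P" "\<And>s. s \<in> S \<Longrightarrow> h (free_gen R s) = g s"
proof -
  interpret P: module R P by fact
  define h where "h f = (\<Oplus>\<^bsub>P\<^esub>s\<in>{s \<in> S. f s \<noteq> \<zero>}. f s \<odot>\<^bsub>P\<^esub> g s)" for f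
  \<comment> \<open>The sum over the support may be taken over any larger finite subset of
    \<open>S\<close>. Additivity needs this, since two functions and their sum have different
    supports.\<close>
  have h_eq: "h f = (\<Oplus>\<^bsub>P\<^esub>s\<in>A. f s \<odot>\<^bsub>P\<^esub> g s)"
    if "f \<in> carrier (free_mod R S)" "finite A" "{s \<in> S. f s \<noteq> \<zero>} \<subseteq> A" "A \<subseteq> S" for f A
    unfolding h_def
  proof (rule P.add.finprod_mono_neutral_cong_left)
    show "f s \<odot>\<^bsub>P\<^esub> g s = \<zero>\<^bsub>P\<^esub>" if "s \<in> A - {s \<in> S. f s \<noteq> \<zero>}" for s
      using that \<open>A \<subseteq> S\<close> g by (auto simp: Pi_iff subset_iff)
    show "(\<lambda>s. f s \<odot>\<^bsub>P\<^esub> g s) \<in> A \<rightarrow> carrier P"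
    proof
      fix s assume "s \<in> A"
      then have "f s \<in> carrier R" "g s \<in> carrier P"
        using that(1,4) g by (auto simp: free_mod_def)
      then show "f s \<odot>\<^bsub>P\<^esub> g s \<in> carrier P" by simp
    qed
  qed (use that in auto)
  show ?thesis
  proof
    show "h \<in> lin_hom R (free_mod R S) P"
    proof (rule lin_homI)
      show "h f \<in> carrier P" if "f \<in> carrier (free_mod R S)" for f
        unfolding h_def using that g by (intro P.finsum_closed) (auto simp: free_mod_def Pi_iff)
      show "h (f \<oplus>\<^bsub>free_mod R S\<^esub> f') = h f \<oplus>\<^bsub>P\<^esub> h f'"
        if f: "f \<in> carrier (free_mod R S)" and f': "f' \<in> carrier (free_mod R S)" for f f'
      proof -
        define A where "A = {s \<in> S. f s \<noteq> \<zero>} \<union> {s \<in> S. f' s \<noteq> \<zero>}"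
        have A: "finite A" "A \<subseteq> S"
          using f f' by (auto simp: A_def free_mod_def)
        have "h (f \<oplus>\<^bsub>free_mod R S\<^esub> f') = (\<Oplus>\<^bsub>P\<^esub>s\<in>A. (f \<oplus>\<^bsub>free_mod R S\<^esub> f') s \<odot>\<^bsub>P\<^esub> g s)"
          using A abelian_monoid.a_closed[OF abelian_group.axioms(1)[OF module.axioms(2)[OF module_free_mod]] f f']
          by (intro h_eq) (auto simp: A_def free_mod_def)
        also have "\<dots> = (\<Oplus>\<^bsub>P\<^esub>s\<in>A. f s \<odot>\<^bsub>P\<^esub> g s \<oplus>\<^bsub>P\<^esub> f' s \<odot>\<^bsub>P\<^esub> g s)"
          using A(2) f f' g
          by (intro P.finsum_cong') (auto simp: free_mod_def Pi_iff subset_iff P.smult_l_distr)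
        also have "\<dots> = (\<Oplus>\<^bsub>P\<^esub>s\<in>A. f s \<odot>\<^bsub>P\<^esub> g s) \<oplus>\<^bsub>P\<^esub> (\<Oplus>\<^bsub>P\<^esub>s\<in>A. f' s \<odot>\<^bsub>P\<^esub> g s)"
          using A(2) f f' g by (intro P.finsum_addf) (auto simp: free_mod_def Pi_iff subset_iff)
        also have "\<dots> = h f \<oplus>\<^bsub>P\<^esub> h f'"
          using A f f' h_eq[of f A] h_eq[of f' A] by (auto simp: A_def)
        finally show ?thesis .
      qed
      show "h (r \<odot>\<^bsub>free_mod R S\<^esub> f) = r \<odot>\<^bsub>P\<^esub> h f"
        if r: "r \<in> carrier R" and f: "f \<in> carrier (free_mod R S)" for r f
      proof -
        define A where "A = {s \<in> S. f s \<noteq> \<zero>}"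
        have A: "finite A" "A \<subseteq> S"
          using f by (auto simp: A_def free_mod_def)
        have "h (r \<odot>\<^bsub>free_mod R S\<^esub> f) = (\<Oplus>\<^bsub>P\<^esub>s\<in>A. (r \<odot>\<^bsub>free_mod R S\<^esub> f) s \<odot>\<^bsub>P\<^esub> g s)"
          using A r f module.smult_closed[OF module_free_mod r f]
          by (intro h_eq) (auto simp: A_def free_mod_def)
        also have "\<dots> = (\<Oplus>\<^bsub>P\<^esub>s\<in>A. r \<odot>\<^bsub>P\<^esub> (f s \<odot>\<^bsub>P\<^esub> g s))"
          using A(2) r f g
          by (intro P.finsum_cong') (auto simp: free_mod_def Pi_iff subset_iff P.smult_assoc1)
        also have "\<dots> = r \<odot>\<^bsub>P\<^esub> h f"
          unfolding h_def A_def[symmetric] using A r f g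
          by (intro P.finsum_smult_ldistr[symmetric]) (auto simp: free_mod_def Pi_iff subset_iff)
        finally show ?thesis .
      qed
    qed
    show "h (free_gen R s) = g s" if s: "s \<in> S" for s
    proof -
      have "h (free_gen R s) = (\<Oplus>\<^bsub>P\<^esub>t\<in>{s}. free_gen R s t \<odot>\<^bsub>P\<^esub> g t)"
        using s free_gen_closed[OF s] by (intro h_eq) (auto simp: free_gen_def)
      also have "\<dots> = g s"
        using s g by (auto simp: free_gen_def P.finsum_insert Pi_iff)
      finally show ?thesis .
    qed
  qed
qed

end

section \<open>Alternating bilinear maps and the universal property of the exterior square\<close>

definition alternating_bilin ::
  "('k, 'q) ring_scheme \<Rightarrow> ('k, 'a, 'm) module_scheme \<Rightarrow> ('k, 'b, 'n) module_scheme \<Rightarrow> ('a \<Rightarrow> 'a \<Rightarrow> 'b) set"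
  where "alternating_bilin R M P = {B \<in> bilin R M M P. \<forall>a\<in>carrier M. B a a = \<zero>\<^bsub>P\<^esub>}"

text \<open>Polarisation: expand \<open>B (a \<oplus> b) (a \<oplus> b)\<close>, where the diagonal
  terms vanish.\<close>

lemma (in module) alternating_bilin_skew:
  assumes "module R P" "B \<in> alternating_bilin R M P" "a \<in> carrier M" "b \<in> carrier M"
  shows "B a b = \<ominus>\<^bsub>P\<^esub> B b a"
proof -
  interpret P: module R P by fact
  have B: "B \<in> bilin R M M P" and self: "B a a = \<zero>\<^bsub>P\<^esub>" "B b b = \<zero>\<^bsub>P\<^esub>"
      "B (a \<oplus>\<^bsub>M\<^esub> b) (a \<oplus>\<^bsub>M\<^esub> b) = \<zero>\<^bsub>P\<^esub>"
    using assms by (auto simp: alternating_bilin_def)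
  have "B a b \<oplus>\<^bsub>P\<^esub> B b a = \<zero>\<^bsub>P\<^esub>"
    using self(3) assms(3,4)
    by (simp add: self(1,2) bilin_closed[OF B] bilin_add_left[OF B] bilin_add_right[OF B] P.a_comm)
  then show ?thesis
    using assms(3,4) by (intro P.minus_equality[symmetric]) (simp_all add: bilin_closed[OF B])
qed

context module
begin

lemma wedge_rels_subset: "wedge_rels R M \<subseteq> carrier (free_mod R (carrier M \<times> carrier M))"
proof -
  interpret F: module R "free_mod R (carrier M \<times> carrier M)" by (rule module_free_mod)
  show ?thesis
    by (auto simp: wedge_rels_def Let_def free_gen_closed)
qed

interpretation F: module R "free_mod R (carrier M \<times> carrier M)" by (rule module_free_mod)

lemma submodule_wedge_ker: "submodule (wedge_ker R M) R (free_mod R (carrier M \<times> carrier M))"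
  unfolding wedge_ker_def by (rule F.submodule_mod_span[OF wedge_rels_subset])

interpretation E: quotient R "free_mod R (carrier M \<times> carrier M)" "wedge_ker R M"
  by (intro quotient.intro submodule_wedge_ker F.module_axioms)

lemma module_ext_sq: "module R (ext_sq R M)"
  unfolding ext_sq_def by (rule E.module_quot)

lemma wedge_closed: "a \<in> carrier M \<Longrightarrow> b \<in> carrier M \<Longrightarrow> wedge R M a b \<in> carrier (ext_sq R M)"
  by (auto simp: wedge_def ext_sq_def E.carrier_quot free_gen_closed)

text \<open>Read through cosets, each law says that a certain element of the free module lies in
  \<open>wedge_ker\<close>, and that element is one of the generators listed in
  \<open>wedge_rels\<close>.\<close>

lemma wedge_alternating_bilin: "wedge R M \<in> alternating_bilin R M (ext_sq R M)"
proof -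
  note [simp] = wedge_def ext_sq_def E.quot_add E.quot_smult E.coset_eq_iff free_gen_closed E.quot_eq_zero_iff
  have "wedge R M \<in> bilin R M M (ext_sq R M)"
  proof (rule bilinI)
    fix a b assume "a \<in> carrier M" "b \<in> carrier M"
    then show "wedge R M a b \<in> carrier (ext_sq R M)" by (rule wedge_closed)
  next
    fix a b c assume "a \<in> carrier M" "b \<in> carrier M" "c \<in> carrier M"
    then show "wedge R M (a \<oplus>\<^bsub>M\<^esub> b) c = wedge R M a c \<oplus>\<^bsub>ext_sq R M\<^esub> wedge R M b c"
      "wedge R M a (b \<oplus>\<^bsub>M\<^esub> c) = wedge R M a b \<oplus>\<^bsub>ext_sq R M\<^esub> wedge R M a c"
      by (simp_all, unfold wedge_ker_def wedge_rels_def Let_def) (intro F.mod_span_base, blast)+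
  next
    fix r a b assume "r \<in> carrier R" "a \<in> carrier M" "b \<in> carrier M"
    then show "wedge R M (r \<odot>\<^bsub>M\<^esub> a) b = r \<odot>\<^bsub>ext_sq R M\<^esub> wedge R M a b"
      "wedge R M a (r \<odot>\<^bsub>M\<^esub> b) = r \<odot>\<^bsub>ext_sq R M\<^esub> wedge R M a b"
      by (simp_all, unfold wedge_ker_def wedge_rels_def Let_def) (intro F.mod_span_base, blast)+
  qed
  moreover have "wedge R M a a = \<zero>\<^bsub>ext_sq R M\<^esub>" if "a \<in> carrier M" for a
    using that by (simp, unfold wedge_ker_def wedge_rels_def Let_def) (intro F.mod_span_base, blast)
  ultimately show ?thesis
    by (simp add: alternating_bilin_def)
qed

text \<open>Transports \<open>free_mod_induct\<close> along the projection, under which free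
  generators become wedges. Identities linear in an argument are checked on wedges by means of this
  rule.\<close>

lemma ext_sq_induct [consumes 1, case_names zero wedge add smult]:
  assumes "x \<in> carrier (ext_sq R M)"
    and "P \<zero>\<^bsub>ext_sq R M\<^esub>"
    and "\<And>a b. a \<in> carrier M \<Longrightarrow> b \<in> carrier M \<Longrightarrow> P (wedge R M a b)"
    and "\<And>x y. x \<in> carrier (ext_sq R M) \<Longrightarrow> y \<in> carrier (ext_sq R M) \<Longrightarrow> P x \<Longrightarrow> P y \<Longrightarrow>
      P (x \<oplus>\<^bsub>ext_sq R M\<^esub> y)"
    and "\<And>r x. r \<in> carrier R \<Longrightarrow> x \<in> carrier (ext_sq R M) \<Longrightarrow> P x \<Longrightarrow> P (r \<odot>\<^bsub>ext_sq R M\<^esub> x)"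
  shows "P x"
proof -
  let ?F = "free_mod R (carrier M \<times> carrier M)" and ?p = "\<lambda>f. wedge_ker R M +>\<^bsub>free_mod R (carrier M \<times> carrier M)\<^esub> f"
  have "P (?p f)" if "f \<in> carrier ?F" for f
    using that
  proof (induction f rule: free_mod_induct)
    case zero
    then show ?case using assms(2) by (simp add: ext_sq_def E.quot_zero)
  next
    case (gen s)
    then show ?case using assms(3) by (auto simp: wedge_def)
  next
    case (add f g)
    then show ?case using assms(4)[of "?p f" "?p g"] by (auto simp: ext_sq_def E.quot_add E.carrier_quot)
  next
    case (smult r f)
    then show ?case using assms(5)[of r "?p f"] by (auto simp: ext_sq_def E.quot_smult E.carrier_quot)
  qed
  then show ?thesis
    using assms(1) by (auto simp: ext_sq_def E.carrier_quot)
qed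

text \<open>Extend \<open>B\<close> linearly to the free module on pairs; alternating bilinearity
  says precisely that the extension kills the relations, so it descends.\<close>

lemma ext_sq_lift:
  assumes "module R P" and B: "B \<in> alternating_bilin R M P"
  obtains h where "h \<in> lin_hom R (ext_sq R M) P" "h \<in> extensional (carrier (ext_sq R M))"
    "\<And>a b. a \<in> carrier M \<Longrightarrow> b \<in> carrier M \<Longrightarrow> h (wedge R M a b) = B a b"
proof -
  let ?F = "free_mod R (carrier M \<times> carrier M)"
  interpret P: module R P by fact
  have bil: "B \<in> bilin R M M P" and alt: "\<And>a. a \<in> carrier M \<Longrightarrow> B a a = \<zero>\<^bsub>P\<^esub>"
    using B by (auto simp: alternating_bilin_def)
  note bil_simps = bilin_closed[OF bil] bilin_add_right[OF bil] bilin_add_left[OF bil]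
    bilin_smult_right[OF bil] bilin_smult_left[OF bil] alt
  obtain f where f: "f \<in> lin_hom R ?F P"
    and f_gen: "\<And>s. s \<in> carrier M \<times> carrier M \<Longrightarrow> f (free_gen R s) = (case s of (a, b) \<Rightarrow> B a b)"
    by (rule free_lift[OF assms(1), of "\<lambda>(a, b). B a b" "carrier M \<times> carrier M"])
      (auto simp: bil_simps)
  have rels: "f r = \<zero>\<^bsub>P\<^esub>" if "r \<in> wedge_rels R M" for r
    using that unfolding wedge_rels_def Let_def
    by (auto simp: F.lin_hom_minus[OF assms(1) f] lin_hom_add[OF f] lin_hom_smult[OF f] f_gen
        free_gen_closed bil_simps P.minus_eq_zero_iff)
  have "f x = \<zero>\<^bsub>P\<^esub>" if "x \<in> wedge_ker R M" for x
    using that[unfolded wedge_ker_def] wedge_rels_subset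
    by (induction x rule: F.mod_span_induct)
      (auto simp: rels F.lin_hom_zero[OF assms(1) f] lin_hom_add[OF f] lin_hom_smult[OF f])
  then obtain h where "h \<in> lin_hom R (ext_sq R M) P" "h \<in> extensional (carrier (ext_sq R M))"
    and h: "\<And>x. x \<in> carrier ?F \<Longrightarrow> h (wedge_ker R M +>\<^bsub>?F\<^esub> x) = f x"
    unfolding ext_sq_def using E.quot_lift[OF assms(1) f] by metis
  from this(1,2) show ?thesis
    by (rule that) (simp add: wedge_def h f_gen free_gen_closed)
qed

lemma ext_sq_lin_hom_eqI:
  assumes "module R P" and f: "f \<in> lin_hom R (ext_sq R M) P" and g: "g \<in> lin_hom R (ext_sq R M) P"
    and "\<And>a b. a \<in> carrier M \<Longrightarrow> b \<in> carrier M \<Longrightarrow> f (wedge R M a b) = g (wedge R M a b)"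
    and "x \<in> carrier (ext_sq R M)"
  shows "f x = g x"
proof -
  interpret E': module R "ext_sq R M" by (rule module_ext_sq)
  show ?thesis
    using assms(5)
    by (induction x rule: ext_sq_induct)
      (simp_all add: assms(4) E'.lin_hom_zero[OF assms(1) f] E'.lin_hom_zero[OF assms(1) g]
        lin_hom_add[OF f] lin_hom_add[OF g] lin_hom_smult[OF f] lin_hom_smult[OF g])
qed

text \<open>Shaped like the descriptions that define \<open>lam\<close> and \<open>end_act\<close>,
  so that \<open>theI'\<close> delivers the properties of both.\<close>

lemma ext_sq_ex1:
  assumes "module R P" and B: "B \<in> alternating_bilin R M P"
  shows "\<exists>!f. f \<in> lin_hom R (ext_sq R M) P \<inter> extensional (carrier (ext_sq R M)) \<and>
    (\<forall>a\<in>carrier M. \<forall>b\<in>carrier M. f (wedge R M a b) = B a b)"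
proof (rule ex_ex1I)
  obtain h where "h \<in> lin_hom R (ext_sq R M) P" "h \<in> extensional (carrier (ext_sq R M))"
    "\<And>a b. a \<in> carrier M \<Longrightarrow> b \<in> carrier M \<Longrightarrow> h (wedge R M a b) = B a b"
    using ext_sq_lift[OF assms] by metis
  then show "\<exists>f. f \<in> lin_hom R (ext_sq R M) P \<inter> extensional (carrier (ext_sq R M)) \<and>
    (\<forall>a\<in>carrier M. \<forall>b\<in>carrier M. f (wedge R M a b) = B a b)"
    by blast
next
  fix f g
  assume f: "f \<in> lin_hom R (ext_sq R M) P \<inter> extensional (carrier (ext_sq R M)) \<and>
      (\<forall>a\<in>carrier M. \<forall>b\<in>carrier M. f (wedge R M a b) = B a b)"
    and g: "g \<in> lin_hom R (ext_sq R M) P \<inter> extensional (carrier (ext_sq R M)) \<and>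
      (\<forall>a\<in>carrier M. \<forall>b\<in>carrier M. g (wedge R M a b) = B a b)"
  show "f = g"
  proof (rule extensionalityI)
    fix x assume "x \<in> carrier (ext_sq R M)"
    then show "f x = g x"
      using f g by - (rule ext_sq_lin_hom_eqI[OF assms(1), of f g]; auto)
  qed (use f g in auto)
qed

end
section \<open>The Lie triple product and its derivations\<close>

lemma end_mod_apply_simps [simp]:
  "x \<in> carrier M \<Longrightarrow> (f \<oplus>\<^bsub>end_mod R M\<^esub> g) x = f x \<oplus>\<^bsub>M\<^esub> g x"
  "x \<in> carrier M \<Longrightarrow> (r \<odot>\<^bsub>end_mod R M\<^esub> f) x = r \<odot>\<^bsub>M\<^esub> f x"
  "x \<in> carrier M \<Longrightarrow> \<zero>\<^bsub>end_mod R M\<^esub> x = \<zero>\<^bsub>M\<^esub>"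
  by (simp_all add: end_mod_def)

lemma carrier_end_mod: "carrier (end_mod R M) = lin_hom R M M \<inter> extensional (carrier M)"
  by (simp add: end_mod_def)

lemma end_mod_eqI:
  assumes "f \<in> carrier (end_mod R M)" "g \<in> carrier (end_mod R M)"
    and "\<And>x. x \<in> carrier M \<Longrightarrow> f x = g x"
  shows "f = g"
  using assms by (auto simp: carrier_end_mod intro: extensionalityI)

context module
begin

lemma module_end_mod: "module R (end_mod R M)"
proof -
  have ext: "f \<oplus>\<^bsub>end_mod R M\<^esub> g \<in> extensional (carrier M)" "r \<odot>\<^bsub>end_mod R M\<^esub> f \<in> extensional (carrier M)"
    "\<zero>\<^bsub>end_mod R M\<^esub> \<in> extensional (carrier M)" for f g r
    by (simp_all add: end_mod_def)
  have add: "f \<oplus>\<^bsub>end_mod R M\<^esub> g \<in> carrier (end_mod R M)"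
    if "f \<in> carrier (end_mod R M)" "g \<in> carrier (end_mod R M)" for f g
  proof -
    from that have f: "f \<in> lin_hom R M M" and g: "g \<in> lin_hom R M M" by (auto simp: carrier_end_mod)
    show ?thesis
      using ext by (auto simp: carrier_end_mod lin_hom_closed[OF f] lin_hom_closed[OF g] lin_hom_add[OF f]
          lin_hom_add[OF g] lin_hom_smult[OF f] lin_hom_smult[OF g] M.a_ac smult_r_distr intro!: lin_homI)
  qed
  have smult: "r \<odot>\<^bsub>end_mod R M\<^esub> f \<in> carrier (end_mod R M)"
    if "r \<in> carrier R" "f \<in> carrier (end_mod R M)" for r f
  proof -
    from that have f: "f \<in> lin_hom R M M" by (auto simp: carrier_end_mod)
    show ?thesis
      using ext that(1) by (auto simp: carrier_end_mod lin_hom_closed[OF f] lin_hom_add[OF f]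
          lin_hom_smult[OF f] smult_r_distr R.m_comm simp flip: smult_assoc1 intro!: lin_homI)
  qed
  have zero: "\<zero>\<^bsub>end_mod R M\<^esub> \<in> carrier (end_mod R M)"
    using ext by (auto simp: carrier_end_mod intro!: lin_homI)
  have closed: "f x \<in> carrier M" if "f \<in> carrier (end_mod R M)" "x \<in> carrier M" for f x
    using that by (auto simp: carrier_end_mod intro: lin_hom_closed)
  show ?thesis
  proof (rule moduleI)
    show "abelian_group (end_mod R M)"
    proof (rule abelian_groupI)
      fix f assume f: "f \<in> carrier (end_mod R M)"
      \<comment> \<open>The negative is \<open>\<ominus> \<one>\<close> times \<open>f\<close>,
        whose membership is covered by \<open>smult\<close>.\<close>
      show "\<exists>g\<in>carrier (end_mod R M). g \<oplus>\<^bsub>end_mod R M\<^esub> f = \<zero>\<^bsub>end_mod R M\<^esub>"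
        using f by (intro bexI[of _ "(\<ominus> \<one>) \<odot>\<^bsub>end_mod R M\<^esub> f"] end_mod_eqI[where R = R and M = M])
          (auto intro!: add smult zero simp: closed smult_l_minus M.l_neg)
    qed (auto intro!: add zero end_mod_eqI[where R = R and M = M] simp: closed M.a_ac)
  qed (rule R.is_cring | auto intro!: add smult end_mod_eqI[where R = R and M = M]
      simp: closed smult_l_distr smult_r_distr smult_assoc1)+
qed

end

section \<open>The untwisted triple product and the Leibniz product on the exterior square\<close>

definition trip :: "('k, 'a, 'm) hom_lts_struct_scheme \<Rightarrow> 'a \<Rightarrow> 'a \<Rightarrow> 'a \<Rightarrow> 'a" where
  "trip T a b c = untwist T (tri T a b c)"

definition der :: "('k, 'q) ring_scheme \<Rightarrow> ('k, 'a, 'm) hom_lts_struct_scheme \<Rightarrow>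
    ('a \<times> 'a \<Rightarrow> 'k) set \<Rightarrow> 'a \<Rightarrow> 'a" where
  "der R T x c = untwist T (lam R T x c)"

text \<open>This is the Leibniz product \<open>x \<bullet> y\<close> of the opening sketch;
  \<open>trip\<close> is its product \<open>{a,b,c}\<close>, and \<open>der\<close> is the
  endomorphism of \<open>T\<close> by which \<open>act\<close> operates on each factor of a
  wedge.\<close>

definition act :: "('k, 'q) ring_scheme \<Rightarrow> ('k, 'a, 'm) hom_lts_struct_scheme \<Rightarrow>
    ('a \<times> 'a \<Rightarrow> 'k) set \<Rightarrow> ('a \<times> 'a \<Rightarrow> 'k) set \<Rightarrow> ('a \<times> 'a \<Rightarrow> 'k) set" where
  "act R T x = end_act R T (lam R T x)"

context regular_hom_lts
begin

abbreviation (input) "E \<equiv> ext_sq R T"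
abbreviation (input) "w \<equiv> wedge R T"

lemma twist_closed: "a \<in> carrier T \<Longrightarrow> twist T a \<in> carrier T"
  by (rule lin_hom_closed[OF twist_lin])

lemma untwist_closed: "a \<in> carrier T \<Longrightarrow> untwist T a \<in> carrier T"
  using twist_bij unfolding untwist_def by (metis bij_betw_imp_surj_on inv_into_into)

lemma twist_untwist: "a \<in> carrier T \<Longrightarrow> twist T (untwist T a) = a"
  using twist_bij unfolding untwist_def by (metis bij_betw_imp_surj_on f_inv_into_f)

lemma untwist_twist: "a \<in> carrier T \<Longrightarrow> untwist T (twist T a) = a"
  using twist_bij unfolding untwist_def by (meson bij_betw_imp_inj_on inv_into_f_f)

lemma untwist_lin: "untwist T \<in> lin_hom R T T"
proof (rule lin_homI)
  show "untwist T (a \<oplus>\<^bsub>T\<^esub> b) = untwist T a \<oplus>\<^bsub>T\<^esub> untwist T b"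
    if "a \<in> carrier T" "b \<in> carrier T" for a b
    using that untwist_twist[of "untwist T a \<oplus>\<^bsub>T\<^esub> untwist T b"]
    by (simp add: lin_hom_add[OF twist_lin] untwist_closed twist_untwist)
  show "untwist T (r \<odot>\<^bsub>T\<^esub> a) = r \<odot>\<^bsub>T\<^esub> untwist T a"
    if "r \<in> carrier R" "a \<in> carrier T" for r a
    using that untwist_twist[of "r \<odot>\<^bsub>T\<^esub> untwist T a"]
    by (simp add: lin_hom_smult[OF twist_lin] untwist_closed twist_untwist)
qed (rule untwist_closed)

lemma tri_lin:
  assumes "a \<in> carrier T" "b \<in> carrier T"
  shows "(\<lambda>c. tri T c a b) \<in> lin_hom R T T" "(\<lambda>c. tri T a c b) \<in> lin_hom R T T"
    "tri T a b \<in> lin_hom R T T"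
  using tri_trilin assms by (auto simp: trilin_def)

lemmas tri_simps = lin_hom_closed[OF tri_lin(3)]
  lin_hom_add[OF tri_lin(1)] lin_hom_add[OF tri_lin(2)] lin_hom_add[OF tri_lin(3)]
  lin_hom_smult[OF tri_lin(1)] lin_hom_smult[OF tri_lin(2)] lin_hom_smult[OF tri_lin(3)]

lemma trip_lin:
  assumes "a \<in> carrier T" "b \<in> carrier T"
  shows "(\<lambda>c. trip T c a b) \<in> lin_hom R T T" "(\<lambda>c. trip T a c b) \<in> lin_hom R T T"
    "trip T a b \<in> lin_hom R T T"
  unfolding trip_def using lin_hom_comp[OF _ untwist_lin] tri_lin[OF assms] by blast+

lemmas trip_simps = lin_hom_closed[OF trip_lin(3)]
  lin_hom_add[OF trip_lin(1)] lin_hom_add[OF trip_lin(2)] lin_hom_add[OF trip_lin(3)]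
  lin_hom_smult[OF trip_lin(1)] lin_hom_smult[OF trip_lin(2)] lin_hom_smult[OF trip_lin(3)]
  lin_hom_zero[OF module_axioms trip_lin(1)] lin_hom_zero[OF module_axioms trip_lin(2)]
  lin_hom_zero[OF module_axioms trip_lin(3)]

lemma tri_eq_twist_trip:
  "a \<in> carrier T \<Longrightarrow> b \<in> carrier T \<Longrightarrow> c \<in> carrier T \<Longrightarrow> tri T a b c = twist T (trip T a b c)"
  by (simp add: trip_def twist_untwist tri_simps)

lemma trip_cyclic:
  "a \<in> carrier T \<Longrightarrow> b \<in> carrier T \<Longrightarrow> c \<in> carrier T \<Longrightarrow>
    trip T a b c \<oplus>\<^bsub>T\<^esub> trip T b c a \<oplus>\<^bsub>T\<^esub> trip T c a b = \<zero>\<^bsub>T\<^esub>"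
  by (simp add: trip_def tri_cyclic tri_simps lin_hom_zero[OF module_axioms untwist_lin]
      flip: lin_hom_add[OF untwist_lin])

lemma twist_trip:
  "a \<in> carrier T \<Longrightarrow> b \<in> carrier T \<Longrightarrow> c \<in> carrier T \<Longrightarrow>
    twist T (trip T a b c) = trip T (twist T a) (twist T b) (twist T c)"
  by (simp add: trip_def twist_untwist tri_simps untwist_twist flip: twist_tri)

lemma untwist_trip:
  assumes "a \<in> carrier T" "b \<in> carrier T" "c \<in> carrier T"
  shows "untwist T (trip T a b c) = trip T (untwist T a) (untwist T b) (untwist T c)"
  using assms untwist_twist[of "trip T (untwist T a) (untwist T b) (untwist T c)"]
  by (simp add: twist_trip untwist_closed twist_untwist trip_simps)

text \<open>Replacing each \<open>tri\<close> by \<open>twist\<close> after \<open>trip\<close> and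
  moving all twists outwards turns \<open>tri_deriv\<close> into this identity under two
  applications of \<open>twist\<close>. Since \<open>untwist\<close> inverts \<open>twist\<close>,
  both can be stripped.\<close>

lemma trip_deriv:
  assumes "a \<in> carrier T" "b \<in> carrier T" "c \<in> carrier T" "d \<in> carrier T" "e \<in> carrier T"
  shows "trip T a b (trip T c d e) =
    trip T (trip T a b c) d e \<oplus>\<^bsub>T\<^esub> trip T c (trip T a b d) e \<oplus>\<^bsub>T\<^esub> trip T c d (trip T a b e)"
    (is "?l = ?r")
proof -
  have "twist T (twist T ?l) = twist T (twist T ?r)"
    using tri_deriv[OF assms] assms
    by (simp add: tri_eq_twist_trip twist_trip twist_closed trip_simps lin_hom_add[OF twist_lin])
  then have "untwist T (untwist T (twist T (twist T ?l))) = untwist T (untwist T (twist T (twist T ?r)))"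
    by simp
  then show ?thesis
    using assms by (simp add: untwist_twist twist_closed trip_simps)
qed

lemma tri_D_closed: "a \<in> carrier T \<Longrightarrow> b \<in> carrier T \<Longrightarrow> tri_D T a b \<in> carrier (end_mod R T)"
  by (simp add: carrier_end_mod tri_D_def tri_lin lin_hom_restrict[OF module_axioms])

lemma tri_D_apply: "c \<in> carrier T \<Longrightarrow> tri_D T a b c = tri T a b c"
  by (simp add: tri_D_def)

lemma tri_D_alternating_bilin: "tri_D T \<in> alternating_bilin R T (end_mod R T)"
proof -
  interpret End: module R "end_mod R T" by (rule module_end_mod)
  have "tri_D T \<in> bilin R T T (end_mod R T)"
    by (rule bilinI) (auto intro!: end_mod_eqI[where R = R and M = T] tri_D_closed simp: tri_D_apply tri_simps)
  moreover have "tri_D T a a = \<zero>\<^bsub>end_mod R T\<^esub>" if "a \<in> carrier T" for a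
    using that by (auto intro!: end_mod_eqI[where R = R and M = T] tri_D_closed simp: tri_D_apply tri_alt)
  ultimately show ?thesis
    by (simp add: alternating_bilin_def)
qed

lemma lam_lin: "lam R T \<in> lin_hom R E (end_mod R T)"
  and lam_wedge: "a \<in> carrier T \<Longrightarrow> b \<in> carrier T \<Longrightarrow> lam R T (w a b) = tri_D T a b"
  using theI'[OF ext_sq_ex1[OF module_end_mod tri_D_alternating_bilin]] unfolding lam_def by auto

lemma twisted_end_lin:
  assumes "X \<in> carrier (end_mod R T)"
  shows "twisted_end T X \<in> lin_hom R T T"
proof -
  have "(\<lambda>c. untwist T (X c)) \<in> lin_hom R T T"
    using assms by (auto simp: carrier_end_mod intro: lin_hom_comp untwist_lin)
  then show ?thesis
    by (rule lin_hom_cong[OF module_axioms]) (simp add: twisted_end_def compose_def)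
qed

sublocale E: module R "ext_sq R T" by (rule module_ext_sq)

lemma wedge_bilin: "w \<in> bilin R T T E" and wedge_self: "a \<in> carrier T \<Longrightarrow> w a a = \<zero>\<^bsub>E\<^esub>"
  using wedge_alternating_bilin by (auto simp: alternating_bilin_def)

lemmas wedge_simps = wedge_closed
  bilin_add_right[OF wedge_bilin] bilin_add_left[OF wedge_bilin]
  bilin_smult_right[OF wedge_bilin] bilin_smult_left[OF wedge_bilin]
  lin_hom_zero[OF module_ext_sq bilin_lin_right[OF wedge_bilin]]
  lin_hom_zero[OF module_ext_sq bilin_lin_left[OF wedge_bilin]]

lemma wedge_skew: "a \<in> carrier T \<Longrightarrow> b \<in> carrier T \<Longrightarrow> w a b = \<ominus>\<^bsub>E\<^esub> w b a"
  by (rule alternating_bilin_skew[OF module_ext_sq wedge_alternating_bilin])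

lemma end_act_alternating_bilin:
  assumes "X \<in> carrier (end_mod R T)"
  shows "(\<lambda>a b. w (twisted_end T X a) b \<oplus>\<^bsub>E\<^esub> w a (twisted_end T X b)) \<in> alternating_bilin R T E"
proof -
  note X = twisted_end_lin[OF assms]
  note X_simps = lin_hom_closed[OF X] lin_hom_add[OF X] lin_hom_smult[OF X]
  have "(\<lambda>a b. w (twisted_end T X a) b \<oplus>\<^bsub>E\<^esub> w a (twisted_end T X b)) \<in> bilin R T T E"
    by (rule bilinI) (auto simp: X_simps wedge_simps E.a_ac E.smult_r_distr)
  \<comment> \<open>The two terms are negatives of each other by skewness.\<close>
  moreover have "w (twisted_end T X a) a \<oplus>\<^bsub>E\<^esub> w a (twisted_end T X a) = \<zero>\<^bsub>E\<^esub>" if "a \<in> carrier T" for a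
    using that by (simp add: wedge_skew[of a] X_simps wedge_simps E.r_neg)
  ultimately show ?thesis
    by (simp add: alternating_bilin_def)
qed

lemma end_act_lin: "X \<in> carrier (end_mod R T) \<Longrightarrow> end_act R T X \<in> lin_hom R E E"
  and end_act_wedge: "X \<in> carrier (end_mod R T) \<Longrightarrow> a \<in> carrier T \<Longrightarrow> b \<in> carrier T \<Longrightarrow>
    end_act R T X (w a b) = w (twisted_end T X a) b \<oplus>\<^bsub>E\<^esub> w a (twisted_end T X b)"
  using theI'[OF ext_sq_ex1[OF module_ext_sq end_act_alternating_bilin]] unfolding end_act_def by auto

lemma der_bilin: "der R T \<in> bilin R E T T"
  unfolding der_def
proof (rule bilinI)
  fix x y c c' r
  assume c: "c \<in> carrier T" and x: "x \<in> carrier E"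
  have lam_x: "lam R T x \<in> lin_hom R T T"
    using lin_hom_closed[OF lam_lin x] by (simp add: carrier_end_mod)
  then show "untwist T (lam R T x c) \<in> carrier T"
    using c by (simp add: untwist_closed lin_hom_closed)
  show "untwist T (lam R T x (c \<oplus>\<^bsub>T\<^esub> c')) = untwist T (lam R T x c) \<oplus>\<^bsub>T\<^esub> untwist T (lam R T x c')"
    if "c' \<in> carrier T"
    using that lin_hom_add[OF lin_hom_comp[OF lam_x untwist_lin] c] by simp
  assume r: "r \<in> carrier R"
  show "untwist T (lam R T x (r \<odot>\<^bsub>T\<^esub> c)) = r \<odot>\<^bsub>T\<^esub> untwist T (lam R T x c)"
    using r c lin_hom_smult[OF lin_hom_comp[OF lam_x untwist_lin]] by simp
  show "untwist T (lam R T (r \<odot>\<^bsub>E\<^esub> x) c) = r \<odot>\<^bsub>T\<^esub> untwist T (lam R T x c)"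
    using r c x by (simp add: lin_hom_smult[OF lam_lin] lin_hom_smult[OF untwist_lin] lin_hom_closed[OF lam_x])
next
  fix x x' c
  assume c: "c \<in> carrier T" and x: "x \<in> carrier E" "x' \<in> carrier E"
  have "lam R T x \<in> lin_hom R T T" "lam R T x' \<in> lin_hom R T T"
    using lin_hom_closed[OF lam_lin] x by (simp_all add: carrier_end_mod)
  then show "untwist T (lam R T (x \<oplus>\<^bsub>E\<^esub> x') c) = untwist T (lam R T x c) \<oplus>\<^bsub>T\<^esub> untwist T (lam R T x' c)"
    using c x by (simp add: lin_hom_add[OF lam_lin] lin_hom_add[OF untwist_lin] lin_hom_closed)
qed

lemma der_wedge: "a \<in> carrier T \<Longrightarrow> b \<in> carrier T \<Longrightarrow> c \<in> carrier T \<Longrightarrow> der R T (w a b) c = trip T a b c"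
  by (simp add: der_def trip_def lam_wedge tri_D_def)

lemmas der_simps = bilin_closed[OF der_bilin]
  bilin_add_right[OF der_bilin] bilin_add_left[OF der_bilin]
  bilin_smult_right[OF der_bilin] bilin_smult_left[OF der_bilin]
  lin_hom_zero[OF module_axioms bilin_lin_right[OF der_bilin]]
  E.lin_hom_zero[OF module_axioms bilin_lin_left[OF der_bilin]]

lemma act_lin_right: "x \<in> carrier E \<Longrightarrow> act R T x \<in> lin_hom R E E"
  unfolding act_def by (rule end_act_lin[OF lin_hom_closed[OF lam_lin]])

lemma act_wedge:
  "x \<in> carrier E \<Longrightarrow> a \<in> carrier T \<Longrightarrow> b \<in> carrier T \<Longrightarrow>
    act R T x (w a b) = w (der R T x a) b \<oplus>\<^bsub>E\<^esub> w a (der R T x b)"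
  by (simp add: act_def end_act_wedge lin_hom_closed[OF lam_lin] twisted_end_def compose_def der_def)

text \<open>\<open>end_act\<close> is described separately for each endomorphism, so linearity in
  the first argument is not immediate. On a wedge it follows from \<open>act_wedge\<close> and
  linearity of \<open>der\<close>, and \<open>ext_sq_induct\<close> does the rest.\<close>

lemma act_bilin: "act R T \<in> bilin R E E E"
proof -
  note right = lin_hom_closed[OF act_lin_right] lin_hom_add[OF act_lin_right] lin_hom_smult[OF act_lin_right]
    E.lin_hom_zero[OF module_ext_sq act_lin_right]
  show ?thesis
  proof (rule bilinI)
    fix x x' y assume "y \<in> carrier E" "x \<in> carrier E" "x' \<in> carrier E"
    then show "act R T (x \<oplus>\<^bsub>E\<^esub> x') y = act R T x y \<oplus>\<^bsub>E\<^esub> act R T x' y"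
      by (induction y rule: ext_sq_induct)
        (simp_all add: right act_wedge der_simps wedge_simps E.a_ac E.smult_r_distr)
  next
    fix r x y assume "y \<in> carrier E" "r \<in> carrier R" "x \<in> carrier E"
    then show "act R T (r \<odot>\<^bsub>E\<^esub> x) y = r \<odot>\<^bsub>E\<^esub> act R T x y"
      by (induction y rule: ext_sq_induct)
        (simp_all add: right act_wedge der_simps wedge_simps E.smult_r_distr E.smult_left_commute[of r])
  qed (simp_all add: right)
qed

lemmas act_simps = bilin_closed[OF act_bilin]
  bilin_add_right[OF act_bilin] bilin_add_left[OF act_bilin]
  bilin_smult_right[OF act_bilin] bilin_smult_left[OF act_bilin]
  E.lin_hom_zero[OF module_ext_sq bilin_lin_right[OF act_bilin]]
  E.lin_hom_zero[OF module_ext_sq bilin_lin_left[OF act_bilin]]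

text \<open>Both sides are linear in \<open>x\<close>, and for a wedge this is
  \<open>trip_deriv\<close>. So every \<open>der R T x\<close> is a derivation of the triple
  product.\<close>

lemma der_trip:
  assumes "x \<in> carrier E" "a \<in> carrier T" "b \<in> carrier T" "c \<in> carrier T"
  shows "der R T x (trip T a b c) =
    trip T (der R T x a) b c \<oplus>\<^bsub>T\<^esub> trip T a (der R T x b) c \<oplus>\<^bsub>T\<^esub> trip T a b (der R T x c)"
  using assms(1)
proof (induction x rule: ext_sq_induct)
  case (wedge d e)
  then show ?case
    using assms(2-4) trip_deriv[of d e a b c] by (simp add: der_wedge trip_simps)
qed (use assms(2-4) in \<open>simp_all add: der_simps trip_simps M.a_ac smult_r_distr\<close>)

text \<open>Both sides are linear in \<open>y\<close>; for a wedge \<open>y\<close> this is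
  \<open>der_trip\<close>. In other words, \<open>der\<close> turns the product \<open>act\<close>
  into the commutator of endomorphisms.\<close>

lemma der_der:
  assumes "x \<in> carrier E" "y \<in> carrier E" "c \<in> carrier T"
  shows "der R T x (der R T y c) = der R T (act R T x y) c \<oplus>\<^bsub>T\<^esub> der R T y (der R T x c)"
  using assms(2)
  by (induction y rule: ext_sq_induct)
    (use assms(1,3) in \<open>simp_all add: der_simps trip_simps act_simps act_wedge wedge_simps der_wedge der_trip
      M.a_ac smult_r_distr\<close>)

text \<open>On a wedge \<open>z\<close> the operators act factor by factor: each factor contributes
  an instance of \<open>der_der\<close>, and the mixed terms are the same on both sides.\<close>

lemma act_leibniz:
  assumes "x \<in> carrier E" "y \<in> carrier E" "z \<in> carrier E"
  shows "act R T x (act R T y z) = act R T (act R T x y) z \<oplus>\<^bsub>E\<^esub> act R T y (act R T x z)"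
  using assms(3)
  by (induction z rule: ext_sq_induct)
    (use assms(1,2) in \<open>simp_all add: der_simps act_simps act_wedge wedge_simps der_der[of x y]
      E.a_ac E.smult_r_distr\<close>)

end

section \<open>The Lie algebra of the Hom-Lie triple system\<close>

context regular_hom_lts
begin

abbreviation (input) "A \<equiv> A_sub R T"
abbreviation (input) "Q \<equiv> ang_mod R T"
abbreviation (input) "proj \<equiv> (\<lambda>x. A_sub R T +>\<^bsub>ext_sq R T\<^esub> x)"
abbreviation (input) "U \<equiv> U_alg R T"

lemma A_sub_eq: "A = mod_span R E {act R T x x | x. x \<in> carrier E}"
  by (simp add: A_sub_def act_def)

lemma act_self_subset: "{act R T x x | x. x \<in> carrier E} \<subseteq> carrier E"
  by (auto simp: act_simps)

sublocale Q: quotient R "ext_sq R T" "A_sub R T"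
  unfolding A_sub_eq
  by (intro quotient.intro E.module_axioms E.submodule_mod_span act_self_subset)

lemma act_self_mem: "x \<in> carrier E \<Longrightarrow> act R T x x \<in> A"
  unfolding A_sub_eq by (rule E.mod_span_base) blast

text \<open>Polarisation of \<open>act_self_mem\<close>: \<open>act\<close> becomes skew modulo
  \<open>A\<close>.\<close>

lemma act_skew_mem:
  assumes "x \<in> carrier E" "y \<in> carrier E"
  shows "act R T x y \<oplus>\<^bsub>E\<^esub> act R T y x \<in> A"
proof -
  let ?p = "act R T x x \<oplus>\<^bsub>E\<^esub> act R T y y" and ?q = "act R T x y \<oplus>\<^bsub>E\<^esub> act R T y x"
  have pq: "?p \<in> carrier E" "?q \<in> carrier E"
    using assms by (simp_all add: act_simps)
  have "act R T (x \<oplus>\<^bsub>E\<^esub> y) (x \<oplus>\<^bsub>E\<^esub> y) = ?p \<oplus>\<^bsub>E\<^esub> ?q"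
    using assms by (simp add: act_simps E.a_ac)
  then have "?p \<oplus>\<^bsub>E\<^esub> ?q \<in> A"
    using act_self_mem[of "x \<oplus>\<^bsub>E\<^esub> y"] assms by simp
  moreover have "?p \<in> A"
    using assms by (intro Q.a_closed act_self_mem)
  ultimately have "(?p \<oplus>\<^bsub>E\<^esub> ?q) \<ominus>\<^bsub>E\<^esub> ?p \<in> A"
    unfolding a_minus_def by (rule Q.a_closed[OF _ Q.a_inv_closed])
  then show ?thesis
    using E.add_minus_cancel_left[OF pq] by simp
qed

text \<open>For equal arguments the two iterated derivations in \<open>der_der\<close> cancel, so
  \<open>der\<close> vanishes on the generators \<open>act R T y y\<close>. This is why
  \<open>mu\<close> exists on the quotient.\<close>

lemma lam_eq_zero_on_A_sub:
  assumes "x \<in> A"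
  shows "lam R T x = \<zero>\<^bsub>end_mod R T\<^esub>"
proof -
  interpret End: module R "end_mod R T" by (rule module_end_mod)
  have base: "lam R T (act R T y y) = \<zero>\<^bsub>end_mod R T\<^esub>" if y: "y \<in> carrier E" for y
  proof (rule end_mod_eqI[where R = R and M = T])
    fix c assume c: "c \<in> carrier T"
    have "der R T (act R T y y) c = \<zero>\<^bsub>T\<^esub>"
      using der_der[OF y y c] y c by (simp add: der_simps act_simps)
    moreover have "lam R T (act R T y y) c \<in> carrier T"
      using lin_hom_closed[OF lam_lin, of "act R T y y"] y c
      by (auto simp: act_simps carrier_end_mod intro: lin_hom_closed)
    \<comment> \<open>Applying \<open>twist\<close> recovers \<open>lam\<close> from
      \<open>der\<close>; this requires the value of \<open>lam\<close> to lie in the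
      carrier.\<close>
    ultimately have "lam R T (act R T y y) c = twist T \<zero>\<^bsub>T\<^esub>"
      by (metis der_def twist_untwist)
    then show "lam R T (act R T y y) c = \<zero>\<^bsub>end_mod R T\<^esub> c"
      using c by (simp add: lin_hom_zero[OF module_axioms twist_lin])
  qed (use y in \<open>auto simp: act_simps intro: lin_hom_closed[OF lam_lin]\<close>)
  show ?thesis
    using assms[unfolded A_sub_eq] act_self_subset
    by (induction x rule: E.mod_span_induct)
      (auto simp: base E.lin_hom_zero[OF module_end_mod lam_lin] lin_hom_add[OF lam_lin] lin_hom_smult[OF lam_lin])
qed

text \<open>\<open>act R T x\<close> depends on \<open>x\<close> only through
  \<open>lam R T x\<close>, so elements of \<open>A\<close> act as zero even before passing to the
  quotient.\<close>

lemma act_A_sub_left: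
  assumes "x \<in> A" "y \<in> carrier E"
  shows "act R T x y = \<zero>\<^bsub>E\<^esub>"
proof -
  have "act R T x y = act R T \<zero>\<^bsub>E\<^esub> y"
    unfolding act_def using assms
    by (simp add: lam_eq_zero_on_A_sub E.lin_hom_zero[OF module_end_mod lam_lin])
  then show ?thesis
    using assms(2) by (simp add: act_simps)
qed

text \<open>One order of the product is zero by \<open>act_A_sub_left\<close>, so skewness modulo
  \<open>A\<close> puts the other order into \<open>A\<close>. Hence \<open>A\<close> is a two-sided
  ideal for \<open>act\<close>.\<close>

lemma act_A_sub_right:
  assumes "x \<in> A" "y \<in> carrier E"
  shows "act R T y x \<in> A"
  using act_skew_mem[of x y] assms by (simp add: act_A_sub_left act_simps Q.a_Hcarr)

lemma ang_mod_eq: "Q = quot_mod E A"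
  by (simp add: ang_mod_def)

sublocale Q: module R "ang_mod R T"
  unfolding ang_mod_eq by (rule Q.module_quot)

lemma proj_simps:
  "x \<in> carrier E \<Longrightarrow> proj x \<in> carrier Q"
  "x \<in> carrier E \<Longrightarrow> y \<in> carrier E \<Longrightarrow> proj (x \<oplus>\<^bsub>E\<^esub> y) = proj x \<oplus>\<^bsub>Q\<^esub> proj y"
  "r \<in> carrier R \<Longrightarrow> x \<in> carrier E \<Longrightarrow> proj (r \<odot>\<^bsub>E\<^esub> x) = r \<odot>\<^bsub>Q\<^esub> proj x"
  "proj \<zero>\<^bsub>E\<^esub> = \<zero>\<^bsub>Q\<^esub>"
  using Q.proj_lin_hom Q.quot_zero by (auto simp: ang_mod_eq lin_hom_def)

lemma proj_cases:
  assumes "X \<in> carrier Q"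
  obtains x where "x \<in> carrier E" "X = proj x"
  using assms by (auto simp: ang_mod_eq Q.carrier_quot)

lemma proj_eq_zero_iff: "x \<in> carrier E \<Longrightarrow> proj x = \<zero>\<^bsub>Q\<^esub> \<longleftrightarrow> x \<in> A"
  by (simp add: ang_mod_eq Q.quot_eq_zero_iff)

lemma proj_wedge: "proj (w a b) = ang R T a b"
  by (simp add: ang_def)

lemma ang_bilin: "ang R T \<in> bilin R T T Q"
  by (rule bilinI) (simp_all add: wedge_simps proj_simps flip: proj_wedge)

lemma ang_lin_hom_eqI:
  assumes "module R P" and f: "f \<in> lin_hom R Q P" and g: "g \<in> lin_hom R Q P"
    and eq: "\<And>a b. a \<in> carrier T \<Longrightarrow> b \<in> carrier T \<Longrightarrow> f (ang R T a b) = g (ang R T a b)"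
    and X: "X \<in> carrier Q"
  shows "f X = g X"
proof -
  have proj: "proj \<in> lin_hom R E Q"
    unfolding ang_mod_eq by (rule Q.proj_lin_hom)
  obtain x where x: "x \<in> carrier E" "X = proj x"
    using X by (rule proj_cases)
  have "f (proj x) = g (proj x)"
    by (rule ext_sq_lin_hom_eqI[OF assms(1) lin_hom_comp[OF proj f] lin_hom_comp[OF proj g] _ x(1)])
      (simp add: proj_wedge eq)
  then show ?thesis
    using x(2) by simp
qed

text \<open>The factorisation of \<open>lam\<close> through the quotient meets the description of
  \<open>mu\<close>, and it is the only map to do so because the elements \<open>ang R T a b\<close>
  span. Computations with \<open>mu\<close> thus reduce to \<open>lam\<close> on
  representatives.\<close>

lemma mu_proj:
  assumes "x \<in> carrier E"
  shows "mu R T (proj x) = lam R T x"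
proof -
  let ?P = "\<lambda>f. f \<in> lin_hom R Q (end_mod R T) \<inter> extensional (carrier Q) \<and>
    (\<forall>a\<in>carrier T. \<forall>b\<in>carrier T. f (ang R T a b) = tri_D T a b)"
  obtain f where f: "f \<in> lin_hom R Q (end_mod R T)" "f \<in> extensional (carrier Q)"
    and f_proj: "\<And>x. x \<in> carrier E \<Longrightarrow> f (proj x) = lam R T x"
    using Q.quot_lift[OF module_end_mod lam_lin lam_eq_zero_on_A_sub] unfolding ang_mod_eq by metis
  have Pf: "?P f"
    using f by (simp add: f_proj wedge_closed lam_wedge flip: proj_wedge)
  have "g = f" if g: "?P g" for g
  proof (rule extensionalityI)
    fix X assume "X \<in> carrier Q"
    then show "g X = f X"
      using g Pf by - (rule ang_lin_hom_eqI[OF module_end_mod, of g f]; simp)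
  qed (use g f in auto)
  then have "mu R T = f"
    unfolding mu_def by (rule the_equality[where P = ?P, OF Pf])
  then show ?thesis
    using f_proj[OF assms] by simp
qed

text \<open>The same for the bracket: \<open>act\<close> descends to the quotient because
  \<open>A\<close> is a two-sided ideal, and the induced map is identified with the
  \<open>THE\<close> in \<open>ang_br\<close>.\<close>

lemma ang_br_proj:
  assumes "x \<in> carrier E" "y \<in> carrier E"
  shows "ang_br R T (proj x) (proj y) = proj (act R T x y)"
proof -
  let ?P = "\<lambda>f. f \<in> bilin R Q Q Q \<and> f \<in> extensional (carrier Q) \<and>
     (\<forall>X\<in>carrier Q. f X \<in> extensional (carrier Q)) \<and>
     (\<forall>a\<in>carrier T. \<forall>b\<in>carrier T. \<forall>c\<in>carrier T. \<forall>d\<in>carrier T.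
        f (ang R T a b) (ang R T c d) =
          ang R T (twisted_end T (tri_D T a b) c) d \<oplus>\<^bsub>Q\<^esub> ang R T c (twisted_end T (tri_D T a b) d))"
  have "(\<lambda>x y. proj (act R T x y)) \<in> bilin R E E Q"
    by (rule bilinI) (simp_all add: act_simps proj_simps)
  moreover have "proj (act R T n x) = \<zero>\<^bsub>Q\<^esub>" if "n \<in> A" "x \<in> carrier E" for n x
    using that by (simp add: act_A_sub_left proj_simps)
  moreover have "proj (act R T x n) = \<zero>\<^bsub>Q\<^esub>" if "n \<in> A" "x \<in> carrier E" for n x
    using that by (simp add: act_A_sub_right proj_eq_zero_iff act_simps Q.a_Hcarr)
  ultimately obtain f where f: "f \<in> bilin R Q Q Q" "f \<in> extensional (carrier Q)"
      "\<And>X. X \<in> carrier Q \<Longrightarrow> f X \<in> extensional (carrier Q)"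
    and f_proj: "\<And>x y. x \<in> carrier E \<Longrightarrow> y \<in> carrier E \<Longrightarrow> f (proj x) (proj y) = proj (act R T x y)"
    using Q.quot_lift_bilin[OF Q.module_axioms[folded ang_mod_eq]] unfolding ang_mod_eq by (smt (verit))
  have twisted: "twisted_end T (tri_D T a b) c = trip T a b c" if "c \<in> carrier T" for a b c
    using that by (simp add: twisted_end_def compose_def tri_D_def trip_def)
  have Pf: "?P f"
    using f by (simp add: f_proj wedge_closed act_wedge der_wedge trip_simps proj_simps twisted flip: proj_wedge)
  have "g = f" if g: "?P g" for g
  proof (rule extensionalityI)
    fix X assume X: "X \<in> carrier Q"
    \<comment> \<open>Uniqueness takes two rounds: here the left argument is a generator and the
      right one arbitrary; afterwards the left one is freed as well.\<close>
    have *: "g (ang R T a b) Y = f (ang R T a b) Y"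
      if "a \<in> carrier T" "b \<in> carrier T" "Y \<in> carrier Q" for a b Y
      by (rule ang_lin_hom_eqI[OF Q.module_axioms _ _ _ that(3)])
        (use g Pf that in \<open>auto intro: bilin_lin_right bilin_closed[OF ang_bilin]\<close>)
    show "g X = f X"
    proof (rule extensionalityI)
      fix Y assume Y: "Y \<in> carrier Q"
      show "g X Y = f X Y"
        by (rule ang_lin_hom_eqI[OF Q.module_axioms bilin_lin_left bilin_lin_left _ X])
          (use g Pf Y * in auto)
    qed (use g f X in auto)
  qed (use g f in auto)
  then have "ang_br R T = f"
    unfolding ang_br_def by (rule the_equality[where P = ?P, OF Pf])
  then show ?thesis
    using f_proj[OF assms] by simp
qed

end

section \<open>Lie algebras with the Jacobi identity in Leibniz form\<close>

context lie_algebra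
begin

lemma br_alternating_bilin: "lie_br L \<in> alternating_bilin R L L"
  by (simp add: alternating_bilin_def br_bilin br_self)

lemmas br_simps = bilin_closed[OF br_bilin]
  bilin_add_right[OF br_bilin] bilin_add_left[OF br_bilin]
  bilin_smult_right[OF br_bilin] bilin_smult_left[OF br_bilin]
  lin_hom_zero[OF module_axioms bilin_lin_right[OF br_bilin]]
  lin_hom_zero[OF module_axioms bilin_lin_left[OF br_bilin]]
  lin_hom_inv[OF module_axioms bilin_lin_right[OF br_bilin]]
  lin_hom_inv[OF module_axioms bilin_lin_left[OF br_bilin]]

lemmas br_skew = alternating_bilin_skew[OF module_axioms br_alternating_bilin]

text \<open>Skewness turns the cyclic sum into the statement that \<open>lie_br L x\<close> is a
  derivation, the form that can be compared with \<open>act\<close>.\<close>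

lemma br_leibniz:
  assumes "x \<in> carrier L" "y \<in> carrier L" "z \<in> carrier L"
  shows "lie_br L x (lie_br L y z) = lie_br L (lie_br L x y) z \<oplus>\<^bsub>L\<^esub> lie_br L y (lie_br L x z)"
proof -
  have "lie_br L (lie_br L x y) z \<oplus>\<^bsub>L\<^esub> \<ominus>\<^bsub>L\<^esub> lie_br L x (lie_br L y z) \<oplus>\<^bsub>L\<^esub> lie_br L y (lie_br L x z) = \<zero>\<^bsub>L\<^esub>"
    using jacobi[OF assms] assms br_skew[of "lie_br L y z" x] br_skew[of "lie_br L z x" y] br_skew[of z x]
    by (simp add: br_simps)
  then have "(lie_br L (lie_br L x y) z \<oplus>\<^bsub>L\<^esub> lie_br L y (lie_br L x z)) \<ominus>\<^bsub>L\<^esub> lie_br L x (lie_br L y z) = \<zero>\<^bsub>L\<^esub>"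
    using assms by (simp add: a_minus_def br_simps M.a_ac)
  then show ?thesis
    using assms by (simp add: M.minus_eq_zero_iff br_simps)
qed

end

lemma lie_hom_comp: "f \<in> lie_hom R L M \<Longrightarrow> g \<in> lie_hom R M N \<Longrightarrow> (\<lambda>x. g (f x)) \<in> lie_hom R L N"
  by (auto simp: lie_hom_def lin_hom_closed intro: lin_hom_comp)

text \<open>The converse passage, from the Leibniz form to the cyclic sum. It fits
  \<open>U_alg\<close>, where \<open>act_leibniz\<close> and \<open>der_der\<close> are already of
  Leibniz type.\<close>

lemma lie_algebraI:
  assumes "module R L" and alt: "lie_br L \<in> alternating_bilin R L L"
    and leibniz: "\<And>x y z. x \<in> carrier L \<Longrightarrow> y \<in> carrier L \<Longrightarrow> z \<in> carrier L \<Longrightarrow>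
      lie_br L x (lie_br L y z) = lie_br L (lie_br L x y) z \<oplus>\<^bsub>L\<^esub> lie_br L y (lie_br L x z)"
  shows "lie_algebra R L"
proof -
  interpret module R L by fact
  have bil: "lie_br L \<in> bilin R L L L" and self: "\<And>x. x \<in> carrier L \<Longrightarrow> lie_br L x x = \<zero>\<^bsub>L\<^esub>"
    using alt by (auto simp: alternating_bilin_def)
  note closed = bilin_closed[OF bil]
  note skew = alternating_bilin_skew[OF module_axioms alt]
  show ?thesis
  proof (intro lie_algebra.intro lie_algebra_axioms.intro module_axioms)
    fix x y z assume *: "x \<in> carrier L" "y \<in> carrier L" "z \<in> carrier L"
    have "lie_br L (lie_br L y z) x = \<ominus>\<^bsub>L\<^esub> (lie_br L (lie_br L x y) z \<oplus>\<^bsub>L\<^esub> lie_br L y (lie_br L x z))"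
      using * skew[of "lie_br L y z" x] by (simp add: leibniz[of x y z] closed)
    moreover have "lie_br L (lie_br L z x) y = lie_br L y (lie_br L x z)"
      using * skew[of "lie_br L z x" y] skew[of z x]
      by (simp add: closed lin_hom_inv[OF module_axioms bilin_lin_right[OF bil]])
    ultimately show "lie_br L (lie_br L x y) z \<oplus>\<^bsub>L\<^esub> lie_br L (lie_br L y z) x \<oplus>\<^bsub>L\<^esub> lie_br L (lie_br L z x) y = \<zero>\<^bsub>L\<^esub>"
      using * by (simp add: closed M.add_neg_add_cancel)
  qed (use bil self in auto)
qed

section \<open>The Lie algebra structure of \<open>U_alg\<close>\<close>

context regular_hom_lts
begin

lemma U_alg_simps:
  "carrier U = carrier Q \<times> carrier T" "\<zero>\<^bsub>U\<^esub> = (\<zero>\<^bsub>Q\<^esub>, \<zero>\<^bsub>T\<^esub>)"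
  "(X, a) \<oplus>\<^bsub>U\<^esub> (Y, b) = (X \<oplus>\<^bsub>Q\<^esub> Y, a \<oplus>\<^bsub>T\<^esub> b)"
  "r \<odot>\<^bsub>U\<^esub> (X, a) = (r \<odot>\<^bsub>Q\<^esub> X, r \<odot>\<^bsub>T\<^esub> a)"
  by (simp_all add: U_alg_def)

lemma module_U_alg: "module R U"
proof (rule moduleI)
  show "abelian_group U"
  proof (rule abelian_groupI)
    fix u assume "u \<in> carrier U"
    then obtain X a where u: "u = (X, a)" "X \<in> carrier Q" "a \<in> carrier T" by (auto simp: U_alg_simps)
    then show "\<exists>v\<in>carrier U. v \<oplus>\<^bsub>U\<^esub> u = \<zero>\<^bsub>U\<^esub>"
      by (intro bexI[of _ "(\<ominus>\<^bsub>Q\<^esub> X, \<ominus>\<^bsub>T\<^esub> a)"]) (auto simp: U_alg_simps Q.l_neg M.l_neg)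
  qed (auto simp: U_alg_simps Q.a_ac M.a_ac)
qed (auto simp: U_alg_simps Q.smult_l_distr Q.smult_r_distr Q.smult_assoc1
    smult_l_distr smult_r_distr smult_assoc1 R.is_cring)

lemma U_cases:
  assumes "u \<in> carrier U"
  obtains x a where "x \<in> carrier E" "a \<in> carrier T" "u = (proj x, a)"
  using assms by (auto simp: U_alg_simps elim: proj_cases)

text \<open>The bracket on representatives: \<open>ang_br\<close> and \<open>mu\<close> give way to
  \<open>act\<close> and \<open>der\<close>, so that later calculations take place in the exterior
  square and in \<open>T\<close>.\<close>

lemma U_br:
  "x \<in> carrier E \<Longrightarrow> y \<in> carrier E \<Longrightarrow> a \<in> carrier T \<Longrightarrow> b \<in> carrier T \<Longrightarrow>
    lie_br U (proj x, a) (proj y, b) =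
      (proj (act R T x y \<oplus>\<^bsub>E\<^esub> w a b), der R T x b \<ominus>\<^bsub>T\<^esub> der R T y a)"
  by (simp add: U_alg_def ang_br_proj mu_proj der_def act_simps wedge_simps proj_simps proj_wedge)

lemma U_proj_simps:
  "x \<in> carrier E \<Longrightarrow> y \<in> carrier E \<Longrightarrow>
    (proj x, a) \<oplus>\<^bsub>U\<^esub> (proj y, b) = (proj (x \<oplus>\<^bsub>E\<^esub> y), a \<oplus>\<^bsub>T\<^esub> b)"
  "r \<in> carrier R \<Longrightarrow> x \<in> carrier E \<Longrightarrow> r \<odot>\<^bsub>U\<^esub> (proj x, a) = (proj (r \<odot>\<^bsub>E\<^esub> x), r \<odot>\<^bsub>T\<^esub> a)"
  by (simp_all add: U_alg_simps proj_simps)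

lemma U_br_alternating_bilin: "lie_br U \<in> alternating_bilin R U U"
proof -
  have "lie_br U \<in> bilin R U U U"
  proof (rule bilinI)
    fix u v assume "u \<in> carrier U" "v \<in> carrier U"
    then obtain x a y b where "x \<in> carrier E" "a \<in> carrier T" "u = (proj x, a)"
      "y \<in> carrier E" "b \<in> carrier T" "v = (proj y, b)"
      by (metis U_cases)
    then show "lie_br U u v \<in> carrier U"
      by (simp add: U_br U_alg_simps proj_simps act_simps wedge_simps der_simps)
  next
    fix u v t assume "u \<in> carrier U" "v \<in> carrier U" "t \<in> carrier U"
    then obtain x a y b z c where *: "x \<in> carrier E" "a \<in> carrier T" "u = (proj x, a)"
      "y \<in> carrier E" "b \<in> carrier T" "v = (proj y, b)"
      "z \<in> carrier E" "c \<in> carrier T" "t = (proj z, c)"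
      by (metis U_cases)
    then show "lie_br U (u \<oplus>\<^bsub>U\<^esub> v) t = lie_br U u t \<oplus>\<^bsub>U\<^esub> lie_br U v t"
      "lie_br U u (v \<oplus>\<^bsub>U\<^esub> t) = lie_br U u v \<oplus>\<^bsub>U\<^esub> lie_br U u t"
      by (simp_all add: U_proj_simps U_br act_simps wedge_simps der_simps E.a_ac M.add_minus_add)
  next
    fix r u v assume r: "r \<in> carrier R" and "u \<in> carrier U" "v \<in> carrier U"
    then obtain x a y b where "x \<in> carrier E" "a \<in> carrier T" "u = (proj x, a)"
      "y \<in> carrier E" "b \<in> carrier T" "v = (proj y, b)"
      by (metis U_cases)
    with r show "lie_br U (r \<odot>\<^bsub>U\<^esub> u) v = r \<odot>\<^bsub>U\<^esub> lie_br U u v"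
      "lie_br U u (r \<odot>\<^bsub>U\<^esub> v) = r \<odot>\<^bsub>U\<^esub> lie_br U u v"
      by (simp_all add: U_proj_simps U_br act_simps wedge_simps der_simps E.smult_r_distr smult_r_distr
          a_minus_def smult_r_minus)
  qed
  \<comment> \<open>The three contributions vanish for different reasons: \<open>act R T x x\<close>
    lies in \<open>A\<close>, the wedge of \<open>a\<close> with itself is zero, and the two
    derivation terms are equal.\<close>
  moreover have "lie_br U u u = \<zero>\<^bsub>U\<^esub>" if "u \<in> carrier U" for u
    using that
    by (elim U_cases) (simp add: U_br U_alg_simps wedge_self act_simps der_simps act_self_mem
        proj_eq_zero_iff M.minus_eq_zero_iff)
  ultimately show ?thesis
    by (simp add: alternating_bilin_def)
qed

lemmas wedge_minus = lin_hom_minus[OF module_ext_sq bilin_lin_right[OF wedge_bilin]]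
  lin_hom_minus[OF module_ext_sq bilin_lin_left[OF wedge_bilin]]

lemmas der_minus = lin_hom_minus[OF module_axioms bilin_lin_right[OF der_bilin]]

lemma lie_algebra_U_alg: "lie_algebra R U"
proof (rule lie_algebraI[OF module_U_alg U_br_alternating_bilin])
  fix u v t assume "u \<in> carrier U" "v \<in> carrier U" "t \<in> carrier U"
  then obtain x a y b z c where uvt: "u = (proj x, a)" "v = (proj y, b)" "t = (proj z, c)"
    and E: "x \<in> carrier E" "y \<in> carrier E" "z \<in> carrier E"
    and T: "a \<in> carrier T" "b \<in> carrier T" "c \<in> carrier T"
    by (metis U_cases)
  note simps = act_simps wedge_simps der_simps trip_simps E T
  \<comment> \<open>\<open>?l\<close> and \<open>?r\<close> represent the
    \<open>\<langle>T,T\<rangle>\<close> components of the two sides of the Leibniz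
    identity.\<close>
  let ?l = "act R T x (act R T y z \<oplus>\<^bsub>E\<^esub> w b c) \<oplus>\<^bsub>E\<^esub> w a (der R T y c \<ominus>\<^bsub>T\<^esub> der R T z b)"
  let ?r = "(act R T (act R T x y \<oplus>\<^bsub>E\<^esub> w a b) z \<oplus>\<^bsub>E\<^esub> w (der R T x b \<ominus>\<^bsub>T\<^esub> der R T y a) c) \<oplus>\<^bsub>E\<^esub>
    (act R T y (act R T x z \<oplus>\<^bsub>E\<^esub> w a c) \<oplus>\<^bsub>E\<^esub> w b (der R T x c \<ominus>\<^bsub>T\<^esub> der R T z a))"
  let ?k = "act R T (w a b) z \<oplus>\<^bsub>E\<^esub> act R T z (w a b)"
  \<comment> \<open>In the exterior square the identity holds only up to \<open>?k\<close>, which is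
    a symmetrised product and hence lies in \<open>A\<close>.\<close>
  have "?l \<oplus>\<^bsub>E\<^esub> ?k = ?r"
    using E.leibniz_wedge_cancel[of "act R T (act R T x y) z" "act R T y (act R T x z)"
        "w (der R T x b) c" "w b (der R T x c)" "w a (der R T y c)" "w a (der R T z b)"
        "act R T (w a b) z" "w (der R T z a) b" "w (der R T y a) c"]
    by (simp add: simps act_wedge wedge_minus act_leibniz[of x y z] wedge_skew[of b "der R T z a"])
  then have "proj ?l \<oplus>\<^bsub>Q\<^esub> proj ?k = proj ?r"
    by (simp add: simps flip: proj_simps(2))
  moreover have "proj ?k = \<zero>\<^bsub>Q\<^esub>"
    by (simp add: simps act_skew_mem proj_eq_zero_iff)
  ultimately have proj: "proj ?l = proj ?r"
    by (simp add: simps proj_simps(1))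
  \<comment> \<open>Now the \<open>T\<close> component. Terms with at least one argument in
    \<open>\<langle>T,T\<rangle>\<close> are settled by \<open>der_der\<close>; those with all three
    arguments in \<open>T\<close> need the cyclic identity.\<close>
  have "trip T b c a = \<ominus>\<^bsub>T\<^esub> (trip T a b c \<oplus>\<^bsub>T\<^esub> trip T c a b)"
    using trip_cyclic[OF T] by (intro M.minus_equality[symmetric]) (simp_all add: simps M.a_ac)
  \<comment> \<open>Skewness of \<open>trip\<close> in its first two arguments is inherited from the
    wedge through \<open>der\<close>.\<close>
  moreover have "trip T a c b = \<ominus>\<^bsub>T\<^esub> trip T c a b"
    using E.lin_hom_inv[OF module_axioms bilin_lin_left[OF der_bilin, of b], of "w c a"]
    by (simp add: wedge_skew[of a c] simps flip: der_wedge)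
  ultimately have "der R T x (der R T y c \<ominus>\<^bsub>T\<^esub> der R T z b) \<ominus>\<^bsub>T\<^esub> der R T (act R T y z \<oplus>\<^bsub>E\<^esub> w b c) a =
    (der R T (act R T x y \<oplus>\<^bsub>E\<^esub> w a b) c \<ominus>\<^bsub>T\<^esub> der R T z (der R T x b \<ominus>\<^bsub>T\<^esub> der R T y a)) \<oplus>\<^bsub>T\<^esub>
    (der R T y (der R T x c \<ominus>\<^bsub>T\<^esub> der R T z a) \<ominus>\<^bsub>T\<^esub> der R T (act R T x z \<oplus>\<^bsub>E\<^esub> w a c) b)"
    using M.leibniz_der_cancel[of "der R T (act R T x y) c" "der R T (act R T x z) b"
        "der R T (act R T y z) a" "der R T y (der R T x c)" "der R T z (der R T x b)"
        "der R T z (der R T y a)" "trip T a b c" "trip T c a b"]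
    by (simp add: simps der_minus der_wedge der_der[of x y] der_der[of x z] der_der[of y z])
  with proj show "lie_br U u (lie_br U v t) = lie_br U (lie_br U u v) t \<oplus>\<^bsub>U\<^esub> lie_br U v (lie_br U u t)"
    unfolding uvt by (simp add: U_br simps U_proj_simps)
qed

end

section \<open>The universal property\<close>

context regular_hom_lts
begin

lemma U_incl_lin: "U_incl R T \<in> lin_hom R T U"
  by (rule lin_homI) (simp_all add: U_incl_def U_alg_simps)

lemma U_incl_proj: "U_incl R T a = (proj \<zero>\<^bsub>E\<^esub>, a)"
  by (simp add: U_incl_def proj_simps)

text \<open>The reason why \<open>T\<close> generates \<open>U_alg\<close> as a Lie algebra: each
  spanning element of \<open>\<langle>T,T\<rangle>\<close> is a bracket of two included
  elements.\<close>

lemma U_br_incl: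
  "a \<in> carrier T \<Longrightarrow> b \<in> carrier T \<Longrightarrow>
    lie_br U (U_incl R T a) (U_incl R T b) = (ang R T a b, \<zero>\<^bsub>T\<^esub>)"
  by (simp add: U_incl_proj U_br act_simps der_simps wedge_simps M.minus_eq_zero_iff proj_wedge)

lemma U_br_br_incl:
  "a \<in> carrier T \<Longrightarrow> b \<in> carrier T \<Longrightarrow> c \<in> carrier T \<Longrightarrow>
    lie_br U (lie_br U (U_incl R T a) (U_incl R T b)) (U_incl R T c) = U_incl R T (trip T a b c)"
  by (simp add: U_br_incl flip: proj_wedge)
    (simp add: U_incl_proj U_br act_simps der_simps wedge_simps der_wedge trip_simps M.a_minus_zero)

lemma U_lin_hom_eqI:
  assumes "module R P" and f: "f \<in> lin_hom R U P" and g: "g \<in> lin_hom R U P"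
    and ang: "\<And>a b. a \<in> carrier T \<Longrightarrow> b \<in> carrier T \<Longrightarrow> f (ang R T a b, \<zero>\<^bsub>T\<^esub>) = g (ang R T a b, \<zero>\<^bsub>T\<^esub>)"
    and incl: "\<And>a. a \<in> carrier T \<Longrightarrow> f (U_incl R T a) = g (U_incl R T a)"
    and u: "u \<in> carrier U"
  shows "f u = g u"
proof -
  have left: "(\<lambda>X. (X, \<zero>\<^bsub>T\<^esub>)) \<in> lin_hom R Q U"
    by (rule lin_homI) (simp_all add: U_alg_simps)
  obtain X a where Xa: "u = (X, a)" "X \<in> carrier Q" "a \<in> carrier T"
    using u by (auto simp: U_alg_simps)
  have "f (X, \<zero>\<^bsub>T\<^esub>) = g (X, \<zero>\<^bsub>T\<^esub>)"
    by (rule ang_lin_hom_eqI[OF assms(1) lin_hom_comp[OF left f] lin_hom_comp[OF left g] ang Xa(2)])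
  moreover have "u = (X, \<zero>\<^bsub>T\<^esub>) \<oplus>\<^bsub>U\<^esub> U_incl R T a"
    using Xa by (simp add: U_alg_simps U_incl_def)
  ultimately show ?thesis
    using Xa by (simp add: lin_hom_add[OF f] lin_hom_add[OF g] lin_hom_closed[OF left]
        lin_hom_closed[OF U_incl_lin] incl)
qed

text \<open>By \<open>U_br_incl\<close> the values on \<open>T\<close> determine those on the
  elements \<open>ang R T a b\<close>, and both together span. This settles uniqueness, commutation
  with the automorphisms, and the inverse of \<open>U_aut\<close>.\<close>

lemma U_lie_hom_eqI:
  assumes "lie_algebra R L" and f: "f \<in> lie_hom R U L" and g: "g \<in> lie_hom R U L"
    and eq: "\<And>a. a \<in> carrier T \<Longrightarrow> f (U_incl R T a) = g (U_incl R T a)"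
    and u: "u \<in> carrier U"
  shows "f u = g u"
proof (rule U_lin_hom_eqI[where f = f and g = g and P = L])
  show "module R L"
    using assms(1) by (rule lie_algebra.axioms)
  show "f \<in> lin_hom R U L" "g \<in> lin_hom R U L"
    using f g by (auto simp: lie_hom_def)
  fix a b assume "a \<in> carrier T" "b \<in> carrier T"
  then show "f (ang R T a b, \<zero>\<^bsub>T\<^esub>) = g (ang R T a b, \<zero>\<^bsub>T\<^esub>)"
    using f g by (simp add: lie_hom_def eq lin_hom_closed[OF U_incl_lin] flip: U_br_incl)
qed (use eq u in auto)

text \<open>The extension principle, stated with the untwisted product so that no automorphism of
  \<open>L\<close> enters. It can then be applied to maps from \<open>T\<close> into
  \<open>U_alg\<close> itself.\<close>

lemma U_lift:
  assumes "lie_algebra R L" and eps: "\<epsilon> \<in> lin_hom R T L"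
    and eps_trip: "\<And>a b c. a \<in> carrier T \<Longrightarrow> b \<in> carrier T \<Longrightarrow> c \<in> carrier T \<Longrightarrow>
      \<epsilon> (trip T a b c) = lie_br L (lie_br L (\<epsilon> a) (\<epsilon> b)) (\<epsilon> c)"
  obtains \<phi> where "\<phi> \<in> lie_hom R U L" "\<phi> \<in> extensional (carrier U)"
    "\<And>a. a \<in> carrier T \<Longrightarrow> \<phi> (U_incl R T a) = \<epsilon> a"
proof -
  interpret L: lie_algebra R L by fact
  note eps_simps = lin_hom_closed[OF eps] lin_hom_add[OF eps] lin_hom_smult[OF eps]
    lin_hom_zero[OF L.module_axioms eps] lin_hom_inv[OF L.module_axioms eps]
  have "(\<lambda>a b. lie_br L (\<epsilon> a) (\<epsilon> b)) \<in> alternating_bilin R T L"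
    by (auto simp: alternating_bilin_def eps_simps L.br_simps L.br_self intro!: bilinI)
  then obtain \<psi> where psi: "\<psi> \<in> lin_hom R E L"
    and psi_wedge: "\<And>a b. a \<in> carrier T \<Longrightarrow> b \<in> carrier T \<Longrightarrow> \<psi> (w a b) = lie_br L (\<epsilon> a) (\<epsilon> b)"
    using ext_sq_lift[OF L.module_axioms] by metis
  note psi_simps = lin_hom_closed[OF psi] lin_hom_add[OF psi] lin_hom_smult[OF psi]
    E.lin_hom_zero[OF L.module_axioms psi]
  \<comment> \<open>On wedges this is the hypothesis on \<open>trip\<close>; linearity in
    \<open>x\<close> extends it.\<close>
  have eps_der: "\<epsilon> (der R T x c) = lie_br L (\<psi> x) (\<epsilon> c)" if "x \<in> carrier E" "c \<in> carrier T" for x c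
    using that
    by (induction x rule: ext_sq_induct)
      (simp_all add: der_simps eps_simps psi_simps L.br_simps der_wedge psi_wedge eps_trip)
  \<comment> \<open>On a wedge \<open>y\<close>, \<open>act\<close> operates on each factor by
    \<open>der\<close>, so \<open>eps_der\<close> reduces the claim to the derivation property of
    the bracket with \<open>\<psi> x\<close>.\<close>
  have psi_act: "\<psi> (act R T x y) = lie_br L (\<psi> x) (\<psi> y)" if "y \<in> carrier E" "x \<in> carrier E" for x y
    using that
  proof (induction y rule: ext_sq_induct)
    case (wedge a b)
    then show ?case
      using L.br_leibniz[of "\<psi> x" "\<epsilon> a" "\<epsilon> b"]
      by (simp add: act_wedge psi_simps psi_wedge eps_der wedge_simps der_simps eps_simps)
  qed (simp_all add: psi_simps act_simps L.br_simps)
  \<comment> \<open>A generator \<open>act R T x x\<close> is sent to the bracket of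
    \<open>\<psi> x\<close> with itself.\<close>
  have "\<psi> x = \<zero>\<^bsub>L\<^esub>" if "x \<in> A" for x
    using that[unfolded A_sub_eq] act_self_subset
    by (induction x rule: E.mod_span_induct) (auto simp: psi_simps psi_act L.br_self)
  then obtain \<chi> where chi: "\<chi> \<in> lin_hom R Q L" and chi_proj: "\<And>x. x \<in> carrier E \<Longrightarrow> \<chi> (proj x) = \<psi> x"
    using Q.quot_lift[OF L.module_axioms psi] unfolding ang_mod_eq by metis
  define \<phi> where "\<phi> = (\<lambda>(X, a) \<in> carrier U. \<chi> X \<oplus>\<^bsub>L\<^esub> \<epsilon> a)"
  have phi: "\<phi> (proj x, a) = \<psi> x \<oplus>\<^bsub>L\<^esub> \<epsilon> a" if "x \<in> carrier E" "a \<in> carrier T" for x a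
    using that by (simp add: \<phi>_def U_alg_simps proj_simps chi_proj)
  show ?thesis
  proof
    have "\<phi> \<in> lin_hom R U L"
    proof (rule lin_homI)
      fix u assume "u \<in> carrier U"
      then show "\<phi> u \<in> carrier L"
        by (elim U_cases) (simp add: phi psi_simps eps_simps)
    next
      fix u v assume "u \<in> carrier U" "v \<in> carrier U"
      then show "\<phi> (u \<oplus>\<^bsub>U\<^esub> v) = \<phi> u \<oplus>\<^bsub>L\<^esub> \<phi> v"
        by (elim U_cases) (simp add: U_proj_simps phi psi_simps eps_simps L.M.a_ac)
    next
      fix r u assume "r \<in> carrier R" "u \<in> carrier U"
      then show "\<phi> (r \<odot>\<^bsub>U\<^esub> u) = r \<odot>\<^bsub>L\<^esub> \<phi> u"
        by (elim U_cases) (simp add: U_proj_simps phi psi_simps eps_simps L.smult_r_distr)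
    qed
    moreover have "\<phi> (lie_br U u v) = lie_br L (\<phi> u) (\<phi> v)" if uv: "u \<in> carrier U" "v \<in> carrier U" for u v
    proof -
      obtain x a y b where *: "x \<in> carrier E" "a \<in> carrier T" "u = (proj x, a)"
        "y \<in> carrier E" "b \<in> carrier T" "v = (proj y, b)"
        using uv by (metis U_cases)
      then show ?thesis
        \<comment> \<open>The minus sign in front of \<open>der R T y a\<close> in the bracket of
          \<open>U_alg\<close> is absorbed by exchanging \<open>\<epsilon> a\<close> and
          \<open>\<psi> y\<close>.\<close>
        using L.br_skew[of "\<epsilon> a" "\<psi> y"]
        by (simp add: U_br phi psi_simps eps_simps act_simps wedge_simps der_simps psi_act psi_wedge
            eps_der L.br_simps a_minus_def L.M.a_ac)
    qed
    ultimately show "\<phi> \<in> lie_hom R U L"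
      by (simp add: lie_hom_def)
    show "\<phi> (U_incl R T a) = \<epsilon> a" if "a \<in> carrier T" for a
      using that by (simp add: U_incl_proj phi psi_simps eps_simps)
  qed (simp add: \<phi>_def)
qed

text \<open>A linear endomorphism of the triple product extends to \<open>U_alg\<close>; the two
  instances of interest are \<open>twist\<close> and \<open>untwist\<close>.\<close>

lemma U_lift_incl:
  assumes "\<gamma> \<in> lin_hom R T T"
    and "\<And>a b c. a \<in> carrier T \<Longrightarrow> b \<in> carrier T \<Longrightarrow> c \<in> carrier T \<Longrightarrow>
      \<gamma> (trip T a b c) = trip T (\<gamma> a) (\<gamma> b) (\<gamma> c)"
  obtains \<phi> where "\<phi> \<in> lie_hom R U U" "\<phi> \<in> extensional (carrier U)"
    "\<And>a. a \<in> carrier T \<Longrightarrow> \<phi> (U_incl R T a) = U_incl R T (\<gamma> a)"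
  by (rule U_lift[OF lie_algebra_U_alg lin_hom_comp[OF assms(1) U_incl_lin]])
    (simp_all add: assms(2) U_br_br_incl lin_hom_closed[OF assms(1)])

lemma U_aut_lie_hom: "U_aut R T \<in> lie_hom R U U"
  and U_aut_incl: "a \<in> carrier T \<Longrightarrow> U_aut R T (U_incl R T a) = U_incl R T (twist T a)"
proof -
  let ?P = "\<lambda>f. f \<in> lin_hom R U U \<inter> extensional (carrier U) \<and>
     (\<forall>a\<in>carrier T. f (U_incl R T a) = U_incl R T (twist T a)) \<and>
     (\<forall>a\<in>carrier T. \<forall>b\<in>carrier T.
        f (ang R T a b, \<zero>\<^bsub>T\<^esub>) = (ang R T (twist T a) (twist T b), \<zero>\<^bsub>T\<^esub>))"
  obtain f where f: "f \<in> lie_hom R U U" "f \<in> extensional (carrier U)"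
    and f_incl: "\<And>a. a \<in> carrier T \<Longrightarrow> f (U_incl R T a) = U_incl R T (twist T a)"
    using U_lift_incl[OF twist_lin twist_trip] by blast
  have f_br: "f (lie_br U u v) = lie_br U (f u) (f v)" if "u \<in> carrier U" "v \<in> carrier U" for u v
    using f(1) that by (simp add: lie_hom_def)
  \<comment> \<open>The prescribed value on \<open>ang R T a b\<close> need not be arranged: it
    follows from writing that element as a bracket of included ones.\<close>
  have Pf: "?P f"
    using f by (auto simp: f_incl f_br lie_hom_def lin_hom_closed[OF U_incl_lin] twist_closed
        simp flip: U_br_incl)
  have "g = f" if g: "?P g" for g
  proof (rule extensionalityI)
    fix u assume "u \<in> carrier U"
    then show "g u = f u"
      using Pf g by - (rule U_lin_hom_eqI[OF module_U_alg, of g f]; simp)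
  qed (use g f in auto)
  then have "U_aut R T = f"
    unfolding U_aut_def by (rule the_equality[where P = ?P, OF Pf])
  then show "U_aut R T \<in> lie_hom R U U"
    "a \<in> carrier T \<Longrightarrow> U_aut R T (U_incl R T a) = U_incl R T (twist T a)"
    using f f_incl by auto
qed

lemma U_aut_lie_aut: "U_aut R T \<in> lie_aut R U"
proof -
  \<comment> \<open>The inverse of \<open>U_aut\<close> is the extension of \<open>untwist\<close>:
    both composites are homomorphisms that agree with the identity on \<open>T\<close>.\<close>
  obtain g where g: "g \<in> lie_hom R U U"
    and g_incl: "\<And>a. a \<in> carrier T \<Longrightarrow> g (U_incl R T a) = U_incl R T (untwist T a)"
    using U_lift_incl[OF untwist_lin untwist_trip] by blast
  have id: "(\<lambda>u. u) \<in> lie_hom R U U"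
    by (auto simp: lie_hom_def intro: lin_homI)
  have "g (U_aut R T u) = u" if "u \<in> carrier U" for u
    by (rule U_lie_hom_eqI[OF lie_algebra_U_alg lie_hom_comp[OF U_aut_lie_hom g] id _ that])
      (simp add: U_aut_incl g_incl twist_closed untwist_twist)
  moreover have "U_aut R T (g u) = u" if "u \<in> carrier U" for u
    by (rule U_lie_hom_eqI[OF lie_algebra_U_alg lie_hom_comp[OF g U_aut_lie_hom] id _ that])
      (simp add: U_aut_incl g_incl untwist_closed twist_untwist)
  moreover have "U_aut R T \<in> carrier U \<rightarrow> carrier U" "g \<in> carrier U \<rightarrow> carrier U"
    using U_aut_lie_hom g by (auto simp: lie_hom_def lin_hom_def)
  ultimately show ?thesis
    using U_aut_lie_hom unfolding lie_aut_def
    by (auto intro!: bij_betw_byWitness[where f' = g])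
qed

text \<open>A double bracket of included elements is the included \<open>trip\<close>, and
  \<open>U_aut\<close> applies to it exactly the \<open>twist\<close> that turns \<open>trip\<close>
  back into \<open>tri\<close>.\<close>

lemma imbedding_U_incl: "imbedding R T U (U_aut R T) (U_incl R T)"
  by (simp add: imbedding_def U_incl_lin U_aut_incl U_br_br_incl tri_eq_twist_trip trip_simps)

lemma universal_property:
  assumes L: "lie_algebra R L" and aut: "\<alpha>L \<in> lie_aut R L" and imb: "imbedding R T L \<alpha>L \<epsilon>"
  shows "\<exists>!\<phi>. \<phi> \<in> lie_hom R U L \<inter> extensional (carrier U) \<and>
    (\<forall>u\<in>carrier U. \<phi> (U_aut R T u) = \<alpha>L (\<phi> u)) \<and> (\<forall>a\<in>carrier T. \<phi> (U_incl R T a) = \<epsilon> a)"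
proof -
  interpret L: lie_algebra R L by fact
  have eps: "\<epsilon> \<in> lin_hom R T L" and eps_twist: "\<And>a. a \<in> carrier T \<Longrightarrow> \<epsilon> (twist T a) = \<alpha>L (\<epsilon> a)"
    using imb by (auto simp: imbedding_def)
  have aut_hom: "\<alpha>L \<in> lie_hom R L L" and aut_inj: "inj_on \<alpha>L (carrier L)"
    using aut by (auto simp: lie_aut_def bij_betw_def)
  have "\<epsilon> (trip T a b c) = lie_br L (lie_br L (\<epsilon> a) (\<epsilon> b)) (\<epsilon> c)"
    if "a \<in> carrier T" "b \<in> carrier T" "c \<in> carrier T" for a b c
  \<comment> \<open>Both sides are compared after \<open>\<alpha>L\<close>, where the imbedding
    condition speaks; injectivity then removes the twist and leaves the hypothesis of
    \<open>U_lift\<close>.\<close>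
  proof (rule inj_onD[OF aut_inj])
    have "\<epsilon> (tri T a b c) = \<alpha>L (lie_br L (lie_br L (\<epsilon> a) (\<epsilon> b)) (\<epsilon> c))"
      using imb that by (simp add: imbedding_def)
    then show "\<alpha>L (\<epsilon> (trip T a b c)) = \<alpha>L (lie_br L (lie_br L (\<epsilon> a) (\<epsilon> b)) (\<epsilon> c))"
      using that by (simp add: tri_eq_twist_trip eps_twist trip_simps)
  qed (use that in \<open>simp_all add: lin_hom_closed[OF eps] L.br_simps trip_simps\<close>)
  then obtain \<phi> where phi: "\<phi> \<in> lie_hom R U L" "\<phi> \<in> extensional (carrier U)"
    and phi_incl: "\<And>a. a \<in> carrier T \<Longrightarrow> \<phi> (U_incl R T a) = \<epsilon> a"
    using U_lift[OF L eps] by metis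
  \<comment> \<open>Both sides are homomorphisms in \<open>u\<close>, and on \<open>T\<close> they
    agree because \<open>\<epsilon>\<close> commutes with the automorphisms.\<close>
  have phi_aut: "\<phi> (U_aut R T u) = \<alpha>L (\<phi> u)" if "u \<in> carrier U" for u
    by (rule U_lie_hom_eqI[OF L lie_hom_comp[OF U_aut_lie_hom phi(1)] lie_hom_comp[OF phi(1) aut_hom] _ that])
      (simp add: U_aut_incl phi_incl twist_closed eps_twist)
  show ?thesis
  proof (rule ex1I[where a = \<phi>])
    fix \<theta>
    assume theta: "\<theta> \<in> lie_hom R U L \<inter> extensional (carrier U) \<and>
      (\<forall>u\<in>carrier U. \<theta> (U_aut R T u) = \<alpha>L (\<theta> u)) \<and> (\<forall>a\<in>carrier T. \<theta> (U_incl R T a) = \<epsilon> a)"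
    show "\<theta> = \<phi>"
    proof (rule extensionalityI)
      fix u assume u: "u \<in> carrier U"
      show "\<theta> u = \<phi> u"
        by (rule U_lie_hom_eqI[OF L _ phi(1) _ u]) (use theta phi_incl in auto)
    qed (use theta phi in auto)
  qed (use phi phi_aut phi_incl in auto)
qed

end

theorem theorem1:
  fixes R :: "('k, 'q) ring_scheme"
    and T :: "('k, 't, 'm) hom_lts_struct_scheme"
  assumes "cring R"
    and "ring_char R \<noteq> 2"
    and "regular_hom_lts R T"
  shows "lie_algebra R (U_alg R T) \<and>
    U_aut R T \<in> lie_aut R (U_alg R T) \<and>
    imbedding R T (U_alg R T) (U_aut R T) (U_incl R T) \<and>
    (\<forall>(L :: ('k, 'l, 'n) lie_struct_scheme) \<alpha>L \<epsilon>.
      lie_algebra R L \<longrightarrow> \<alpha>L \<in> lie_aut R L \<longrightarrow> imbedding R T L \<alpha>L \<epsilon> \<longrightarrow>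
      (\<exists>!\<phi>. \<phi> \<in> lie_hom R (U_alg R T) L \<inter> extensional (carrier (U_alg R T)) \<and>
        (\<forall>u\<in>carrier (U_alg R T). \<phi> (U_aut R T u) = \<alpha>L (\<phi> u)) \<and>
        (\<forall>a\<in>carrier T. \<phi> (U_incl R T a) = \<epsilon> a)))"
proof -
  interpret regular_hom_lts R T by fact
  show ?thesis
    using lie_algebra_U_alg U_aut_lie_aut imbedding_U_incl universal_property by blast
qed

end
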